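(* Let $p$ be an odd prime, $m\in\mathbb{N}$ and $q=p^m\ge 5$, and assume $3\mid\frac{q-1}{p-1}$. Put $n=\frac{q-1}{3}$. Then the generalized Paley sum graph $\Gamma^+(3,q)$ is connected and all its eigenvalues are integers; more precisely: (a) If $p\equiv 1\pmod 3$, then $m=3t$ for some $t\in\mathbb{N}$, and for integers $a,b$ with $4\sqrt[3]{q}=a^2+27b^2$, $a\equiv1\pmod 3$, $\gcd(a,p)=1$ ($a$ unique, $b$ unique up to sign), the eigenvalues of $\Gamma^+(3,q)$, listed with multiplicity, are: $n$ once, and each of $$\pm\tfrac{a\sqrt[3]{q}-1}{3},\qquad \pm\tfrac{-\frac12(a+9b)\sqrt[3]{q}-1}{3},\qquad \pm\tfrac{-\frac12(a-9b)\sqrt[3]{q}-1}{3}$$ (all six values, one for each choice of sign) with multiplicity $\frac n2$. (b) If $p\equiv 2\pmod 3$, then $m=2t$ for some $t\in\mathbb{N}$, and the eigenvalues of $\Gamma^+(3,q)$, listed with multiplicity, are: if $m\equiv0\pmod 4$, $n$ once, each of $\pm\frac{\sqrt q-1}{3}$ with multiplicity $n$ and each of $\pm\frac{-2\sqrt q-1}{3}$ with multiplicity $\frac n2$; if $m\equiv 2\pmod 4$, $n$ once, each of $\pm\frac{2\sqrt q-1}{3}$ with multiplicity $\frac n2$ and each of $\pm\frac{-\sqrt q-1}{3}$ with multiplicity $n$.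
   Context: For a prime power $q$ and $k\mid q-1$, let $R_k=\{x^k: x\in\mathbb{F}_q^*\}$. The generalized Paley sum graph $\Gamma^+(k,q)$ is the Cayley sum graph on vertex set $\mathbb{F}_q$: its adjacency matrix $A$ is indexed by $\mathbb{F}_q$ with $A_{v,w}=1$ if $v+w\in R_k$ and $A_{v,w}=0$ otherwise (so there is a loop at $v$ when $2v\in R_k$). Its eigenvalues are those of $A$. The notation "$\pm x$ with multiplicity $e$" means both $x$ and $-x$ occur, each with multiplicity $e$. *)

theory Defs
  imports
    "HOL-Analysis.Analysis"
    "HOL-Computational_Algebra.Computational_Algebra"
    "HOL-Number_Theory.Cong"
    "Graph_Theory.Digraph_Component"
begin

text \<open>
  The field with \<open>q\<close> elements is rendered as an arbitrary type \<open>'a :: {field, finite}\<close> with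
  \<open>CARD('a) = q\<close>.
\<close>

definition power_residues :: "nat \<Rightarrow> 'a::{field,finite} set" where
  "power_residues k = {x ^ k | x. x \<noteq> 0}"

text \<open>
  An undirected edge is a symmetric pair of arcs, and a loop is an arc \<open>(v, v)\<close>.
  (The arc set below is symmetric because addition commutes.)
\<close>

definition gen_paley_sum_graph :: "nat \<Rightarrow> 'a::{field,finite} pair_pre_digraph" where
  "gen_paley_sum_graph k = \<lparr>pverts = UNIV, parcs = {(v, w). v + w \<in> power_residues k}\<rparr>"

definition adjacency_matrix :: "'a::finite pair_pre_digraph \<Rightarrow> complex^'a^'a" where
  "adjacency_matrix G = (\<chi> v w. if (v, w) \<in> parcs G then 1 else 0)"

text \<open>\<open>HOL-Analysis\<close> has no characteristic polynomial: this is \<open>det (X I - M)\<close>.\<close>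

definition charpoly :: "'b::comm_ring_1^'n^'n \<Rightarrow> 'b poly" where
  "charpoly M = det (mat [:0, 1:] - (\<chi> i j. [:M $ i $ j:]))"

text \<open>
  Eigenvalues with algebraic multiplicity. All graphs considered have a real symmetric adjacency
  matrix, so this is also the geometric multiplicity.
\<close>

definition graph_eigenvalues :: "'a::finite pair_pre_digraph \<Rightarrow> complex multiset" where
  "graph_eigenvalues G = proots (charpoly (adjacency_matrix G))"

definition pm_mult :: "real \<Rightarrow> nat \<Rightarrow> complex multiset" where
  "pm_mult x e = replicate_mset e (of_real x) + replicate_mset e (of_real (- x))"

text \<open>Consistency of the definition of \<^const>\<open>charpoly\<close> with eigenvectors.\<close>

lemma poly_charpoly:
  fixes M :: "'b::comm_ring_1^'n^'n"
  shows "poly (charpoly M) x = det (mat x - M)"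
proof -
  have "poly ((mat [:0, 1:] - (\<chi> i j. [:M $ i $ j:])) $ i $ j) x = (mat x - M) $ i $ j" for i j
    by (simp add: mat_def)
  then have "poly (of_int (sign p) * (\<Prod>i\<in>UNIV. (mat [:0, 1:] - (\<chi> i j. [:M $ i $ j:])) $ i $ p i)) x
      = of_int (sign p) * (\<Prod>i\<in>UNIV. (mat x - M) $ i $ p i)" for p :: "'n \<Rightarrow> 'n"
    by (simp add: poly_prod del: vector_minus_component)
  then show ?thesis
    by (simp add: charpoly_def det_def poly_sum del: vector_minus_component)
qed

lemma poly_charpoly_eq_0_iff:
  fixes M :: "'b::field^'n^'n"
  shows "poly (charpoly M) x = 0 \<longleftrightarrow> (\<exists>v. v \<noteq> 0 \<and> M *v v = x *s v)"
proof -
  have m: "mat x *v v = x *s v" for v :: "'b^'n"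
    by (simp add: matrix_vector_mult_def mat_def vec_eq_iff if_distrib if_distribR sum.delta' cong: if_cong)
  have "poly (charpoly M) x = 0 \<longleftrightarrow> \<not> (\<exists>B. B ** (mat x - M) = mat 1)"
    by (metis poly_charpoly invertible_det_nz invertible_left_inverse)
  also have "\<dots> \<longleftrightarrow> (\<exists>v. v \<noteq> 0 \<and> (mat x - M) *v v = 0)"
    by (metis matrix_left_invertible_ker matrix_vector_mult_0_right)
  also have "\<dots> \<longleftrightarrow> (\<exists>v. v \<noteq> 0 \<and> M *v v = x *s v)"
    by (auto simp: matrix_vector_mult_diff_rdistrib m)
  finally show ?thesis .
qed

end

theory Submission
  imports Defs
begin

text \<open>
  Let \<open>\<psi>\<close> be an additive character of the field. The adjacency matrix maps \<open>v \<mapsto> \<psi> (y * v)\<close> to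
  \<open>\<eta> y\<close> times its conjugate, where \<open>\<eta> y\<close> is the cubic Gaussian period, so the eigenvalues other
  than \<open>n\<close> are \<open>\<plusminus>\<eta> y\<close>, and \<open>\<eta>\<close> is constant on each of the three cosets of the cubes. Since
  \<open>(p - 1) * 3\<close> divides \<open>q - 1\<close>, the prime field's units are cubes, and the periods are integers.

  The numbers \<open>x, y, z = 1 + 3 * \<eta>\<close> satisfy \<open>x + y + z = 0\<close>, \<open>x\<^sup>2 + y\<^sup>2 + z\<^sup>2 = 6 * q\<close> and
  \<open>(q - 1) * x * y * z = q * (M - q\<^sup>2)\<close>, where \<open>M\<close> counts the affine zeros of the Fermat cubic. If
  \<open>p \<equiv> 2\<close> modulo 3, then \<open>x\<^sup>2 + x * y + y\<^sup>2 = 3 * q\<close> determines them by descent. If \<open>p \<equiv> 1\<close> modulo 3, then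
  \<open>M \<equiv> 2 * n choose n\<close> modulo \<open>p\<close>, which by Lucas does not vanish; this replaces Stickelberger's theorem
  and shows that each of \<open>x, y, z\<close> is exactly divisible by the cube root of \<open>q\<close>. The cofactors
  yield the representation by \<open>a\<^sup>2 + 27 * b\<^sup>2\<close>.
\<close>

section \<open>Binomial coefficients and binary quadratic forms\<close>

text \<open>By absorption, \<open>l * (p * A choose l)\<close> is a multiple of \<open>p\<close>,
  while \<open>l\<close> is prime to \<open>p\<close>.\<close>

lemma prime_dvd_choose_mult:
  fixes p :: nat
  assumes "prime p" "\<not> p dvd l"
  shows "p dvd (p * A choose l)"
proof -
  have "l > 0" using assms by (cases l) auto
  then have "l * (p * A choose l) = p * A * ((p * A - 1) choose (l - 1))"
    by (rule times_binomial_minus1_eq)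
  then have "p dvd l * (p * A choose l)" by simp
  then show ?thesis using assms by (simp add: prime_dvd_mult_iff)
qed

text \<open>Split \<open>p * Suc A\<close> as \<open>p + p * A\<close> in Vandermonde's identity.
  Modulo \<open>p\<close> only \<open>k = 0\<close> and \<open>k = p\<close> survive, and what
  remains is Pascal's rule.\<close>

lemma choose_mult_prime_cong:
  fixes p :: nat
  assumes "prime p"
  shows "[p * A choose (p * B) = A choose B] (mod p)"
proof (induction A arbitrary: B)
  case 0
  show ?case using prime_gt_0_nat[OF assms] by (cases B) (auto simp: binomial_eq_0)
next
  case (Suc A)
  show ?case
  proof (cases B)
    case (Suc C)
    have "p * Suc A choose (p * B) = (\<Sum>k\<le>p * B. (p choose k) * (p * A choose (p * B - k)))"
      using vandermonde[of p "p * A" "p * B"] by simp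
    also have "[\<dots> = (\<Sum>k\<le>p * B. if k \<in> {0, p} then p * A choose (p * B - k) else 0)] (mod p)"
    proof (rule cong_sum)
      fix k
      have "p dvd (p choose k)" if "k \<noteq> 0" "k \<noteq> p"
        using that assms by (cases "k < p") (auto simp: dvd_choose_prime binomial_eq_0)
      then show "[(p choose k) * (p * A choose (p * B - k)) =
            (if k \<in> {0, p} then p * A choose (p * B - k) else 0)] (mod p)"
        by (auto simp: cong_0_iff)
    qed
    also have "(\<Sum>k\<le>p * B. if k \<in> {0, p} then p * A choose (p * B - k) else 0) =
        (\<Sum>k\<in>{0, p}. p * A choose (p * B - k))"
      by (subst sum.inter_restrict[symmetric]) (use Suc in \<open>auto intro: sum.cong\<close>)
    also have "\<dots> = (p * A choose (p * B)) + (p * A choose (p * C))"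
      using prime_gt_0_nat[OF assms] Suc by simp
    also have "[\<dots> = (A choose B) + (A choose C)] (mod p)"
      by (intro cong_add Suc.IH)
    finally show ?thesis using Suc by (simp add: add.commute)
  qed auto
qed

text \<open>One digit of Lucas's theorem, again from Vandermonde's identity: since \<open>a\<close>
  and \<open>b\<close> are digits, \<open>p * B + b - k\<close> is a multiple of \<open>p\<close>
  for no \<open>k \<le> a\<close> other than \<open>b\<close>.\<close>

lemma lucas_step:
  fixes p :: nat
  assumes "prime p" "a < p" "b < p"
  shows "[p * A + a choose (p * B + b) = (A choose B) * (a choose b)] (mod p)"
proof -
  have "p * A + a choose (p * B + b) = (\<Sum>k\<le>p * B + b. (a choose k) * (p * A choose (p * B + b - k)))"
    using vandermonde[of a "p * A" "p * B + b"] by (simp add: add.commute)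
  also have "[\<dots> = (\<Sum>k\<le>p * B + b. if k = b then (a choose b) * (p * A choose (p * B)) else 0)] (mod p)"
  proof (rule cong_sum)
    fix k assume k: "k \<in> {..p * B + b}"
    have "p dvd (p * A choose (p * B + b - k))" if "k \<noteq> b" "k \<le> a"
    proof (rule prime_dvd_choose_mult[OF assms(1)])
      show "\<not> p dvd p * B + b - k"
      proof
        assume "p dvd p * B + b - k"
        with k have "[p * B + b = k] (mod p)"
          by (simp add: cong_altdef_nat)
        then have "[b = k] (mod p)" by (simp add: cong_def)
        with that assms show False by (auto simp: cong_def)
      qed
    qed
    then show "[(a choose k) * (p * A choose (p * B + b - k)) =
        (if k = b then (a choose b) * (p * A choose (p * B)) else 0)] (mod p)"
      by (cases "k \<le> a") (auto simp: cong_0_iff binomial_eq_0)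
  qed
  also have "(\<Sum>k\<le>p * B + b. if k = b then (a choose b) * (p * A choose (p * B)) else 0) =
      (a choose b) * (p * A choose (p * B))"
    by simp
  also have "[\<dots> = (a choose b) * (A choose B)] (mod p)"
    by (intro cong_mult choose_mult_prime_cong assms cong_refl)
  finally show ?thesis by (simp add: mult.commute)
qed

lemma prime_not_dvd_choose:
  fixes p :: nat
  assumes "prime p" "b \<le> a" "a < p"
  shows "\<not> p dvd (a choose b)"
proof
  assume "p dvd (a choose b)"
  then have "p dvd fact b * fact (a - b) * (a choose b)" by simp
  also have "fact b * fact (a - b) * (a choose b) = (fact a :: nat)"
    using binomial_fact_lemma[OF assms(2)] .
  finally show False using assms by (simp add: prime_dvd_fact_iff)
qed

text \<open>All base-\<open>p\<close> digits of \<open>(p ^ m - 1) div 3\<close> equal \<open>(p - 1) div 3\<close>, so doubling causes no carry.\<close>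

lemma prime_not_dvd_central_binomial:
  fixes p :: nat
  assumes "prime p" "p = 3 * k + 1" "n = (p ^ m - 1) div 3"
  shows "\<not> p dvd (2 * n choose n)"
  using assms(3)
proof (induction m arbitrary: n)
  case 0
  then show ?case using assms(1) by auto
next
  case (Suc m)
  define r where "r = (p ^ m - 1) div 3"
  have "[p ^ m = 1 ^ m] (mod 3)"
    by (rule cong_pow) (simp add: assms(2) cong_def)
  then have "3 dvd p ^ m - 1" by (intro cong_to_1_nat) simp
  moreover have "p ^ m > 0" using assms(1) by (simp add: prime_gt_0_nat)
  ultimately have "p ^ m = 3 * r + 1" by (simp add: r_def)
  then have "p ^ Suc m = 3 * (p * r + k) + 1"
    by (simp add: algebra_simps) (simp add: assms(2))
  then have n: "n = p * r + k" using Suc.prems by simp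
  have "[2 * n choose n = (2 * r choose r) * (2 * k choose k)] (mod p)"
    using lucas_step[OF assms(1), of "2 * k" k "2 * r" r] assms(2)
    by (simp add: n algebra_simps)
  moreover have "\<not> p dvd (2 * r choose r)" using Suc.IH r_def by simp
  moreover have "\<not> p dvd (2 * k choose k)"
    by (rule prime_not_dvd_choose) (use assms in auto)
  ultimately show ?case
    using assms(1) by (auto simp: cong_dvd_iff prime_dvd_mult_iff)
qed

section \<open>The form \<open>x ^ 2 + x * y + y ^ 2\<close> at primes congruent to 2 modulo
  3\<close>

lemma prime_power_cong_self:
  fixes z :: int and p :: nat
  assumes "prime p"
  shows "[z ^ p = z] (mod int p)"
proof -
  have nat: "[int n ^ p = int n] (mod int p)" for n
  proof (induction n)
    case 0
    then show ?case using prime_gt_0_nat[OF assms] by (simp add: power_0_left)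
  next
    case (Suc n)
    have "(int n + 1) ^ p = (\<Sum>k\<le>p. int (p choose k) * int n ^ k)"
      using binomial_ring[of "int n" 1 p] by simp
    also have "[\<dots> = (\<Sum>k\<le>p. if k \<in> {0, p} then int n ^ k else 0)] (mod int p)"
    proof (rule cong_sum)
      fix k
      have "p dvd (p choose k)" if "k \<noteq> 0" "k \<noteq> p"
        using that assms by (cases "k < p") (auto simp: dvd_choose_prime binomial_eq_0)
      then show "[int (p choose k) * int n ^ k = (if k \<in> {0, p} then int n ^ k else 0)] (mod int p)"
        by (auto simp: cong_0_iff)
    qed
    also have "(\<Sum>k\<le>p. if k \<in> {0, p} then int n ^ k else 0) = (\<Sum>k\<in>{0, p}. int n ^ k)"
      by (subst sum.inter_restrict[symmetric]) (auto intro: sum.cong)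
    also have "\<dots> = 1 + int n ^ p" using prime_gt_0_nat[OF assms] by simp
    also have "[\<dots> = 1 + int n] (mod int p)" by (intro cong_add Suc cong_refl)
    finally show ?case by (simp add: add.commute)
  qed
  \<comment> \<open>Fermat's little theorem passes from the naturals to all integers through the
    residue of \<open>z\<close>, which is nonnegative.\<close>
  have "int p > 0" using assms by (simp add: prime_gt_0_nat)
  then have z: "z mod int p = int (nat (z mod int p))" by simp
  have "[z ^ p = (z mod int p) ^ p] (mod int p)" by (intro cong_pow) (simp add: cong_def)
  also have "[(z mod int p) ^ p = z mod int p] (mod int p)" using nat z by metis
  also have "[z mod int p = z] (mod int p)" by (simp add: cong_def)
  finally show ?thesis .
qed

text \<open>The difference of the cubes of \<open>x\<close> and \<open>y\<close> is a multiple of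
  the form, so the cubes agree modulo \<open>p\<close>. Since \<open>p - 1 = 3 * k + 1\<close>, the
  inverse of a unit \<open>z\<close> is \<open>(z ^ 3) ^ k\<close>, so cubing is injective on units.
  Units \<open>x\<close> and \<open>y\<close> would thus agree, and \<open>p\<close> would divide
  \<open>3 * y ^ 2\<close>.\<close>

lemma prime_divides_quadratic_form:
  fixes x y :: int and p :: nat
  assumes "prime p" "odd p" "[p = 2] (mod 3)" "int p dvd x\<^sup>2 + x * y + y\<^sup>2"
  shows "int p dvd x \<and> int p dvd y"
proof -
  have p: "prime (int p)" using assms(1) by simp
  obtain k where k: "p = 3 * k + 2"
    using assms(3) by (metis cong_def mod_less mod_mult_div_eq add.commute numeral_2_eq_2 numeral_3_eq_3 lessI mult.commute)
  have cubes: "[x ^ 3 = y ^ 3] (mod int p)"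
  proof -
    have "x ^ 3 - y ^ 3 = (x - y) * (x\<^sup>2 + x * y + y\<^sup>2)"
      by (simp add: algebra_simps power2_eq_square power3_eq_cube)
    then show ?thesis using assms(4) by (simp add: cong_iff_dvd_diff)
  qed
  have y_if: "int p dvd x" if "int p dvd y"
  proof -
    have "int p dvd x ^ 3" using that cubes by (metis cong_dvd_iff dvd_power zero_less_numeral dvd_trans)
    then show ?thesis using p prime_dvd_power by blast
  qed
  moreover have "int p dvd y"
  proof (rule ccontr)
    assume ny: "\<not> int p dvd y"
    then have nx: "\<not> int p dvd x"
      using cubes p by (metis cong_dvd_iff prime_dvd_power_iff zero_less_numeral)
    have fermat: "[z * (z ^ 3) ^ k = 1] (mod int p)" if "\<not> int p dvd z" for z
    proof -
      have "coprime z (int p)"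
        using that p by (metis coprime_commute prime_imp_coprime)
      moreover have "[z * z ^ (p - 1) = z * 1] (mod int p)"
        using prime_power_cong_self[OF assms(1)] prime_gt_0_nat[OF assms(1)] by (simp flip: power_Suc)
      ultimately have "[z ^ (p - 1) = 1] (mod int p)" by (simp only: cong_mult_lcancel)
      moreover have "z ^ (p - 1) = z * (z ^ 3) ^ k" by (simp add: k power_mult)
      ultimately show ?thesis by simp
    qed
    have "[x * (x ^ 3) ^ k = y * (y ^ 3) ^ k] (mod int p)"
      using fermat[OF nx] fermat[OF ny] cong_sym cong_trans by blast
    moreover have "[y * (y ^ 3) ^ k = y * (x ^ 3) ^ k] (mod int p)"
      by (intro cong_mult cong_pow cong_refl cong_sym[OF cubes])
    ultimately have "[x * (x ^ 3) ^ k = y * (x ^ 3) ^ k] (mod int p)" by (rule cong_trans)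
    moreover have "coprime ((x ^ 3) ^ k) (int p)"
      using nx p by (metis coprime_commute coprime_power_right_iff prime_imp_coprime)
    ultimately have xy: "[x = y] (mod int p)" by (simp add: cong_mult_rcancel)
    have "[x\<^sup>2 + x * y + y\<^sup>2 = y\<^sup>2 + y * y + y\<^sup>2] (mod int p)"
      by (intro cong_add cong_mult cong_pow cong_refl xy)
    then have "int p dvd 3 * y\<^sup>2" using assms(4) by (simp add: cong_dvd_iff power2_eq_square)
    moreover have "\<not> int p dvd 3"
    proof
      assume "int p dvd 3"
      then have "p dvd 3" by presburger
      then have "p \<le> 3" by (rule dvd_imp_le) simp
      then have "p = 0 \<or> p = 1 \<or> p = 2 \<or> p = 3" by linarith
      then show False using assms(1-3) by (auto simp: cong_def)
    qed
    ultimately show False using p ny prime_dvd_mult_iff prime_dvd_power by blast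
  qed
  ultimately show ?thesis by blast
qed

text \<open>Descent: dividing \<open>x\<close> and \<open>y\<close> by \<open>p\<close> lowers
  \<open>t\<close> by one.\<close>

lemma prime_power_divides_quadratic_form:
  fixes x y :: int and p :: nat
  assumes "prime p" "odd p" "[p = 2] (mod 3)" "x\<^sup>2 + x * y + y\<^sup>2 = 3 * int p ^ (2 * t)"
  shows "int p ^ t dvd x \<and> int p ^ t dvd y"
  using assms(4)
proof (induction t arbitrary: x y)
  case (Suc t)
  have "int p dvd x \<and> int p dvd y"
    by (rule prime_divides_quadratic_form[OF assms(1-3)]) (simp add: Suc.prems)
  then obtain u v where uv: "x = int p * u" "y = int p * v" by (auto elim!: dvdE)
  have "(int p)\<^sup>2 * (u\<^sup>2 + u * v + v\<^sup>2) = (int p)\<^sup>2 * (3 * int p ^ (2 * t))"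
    using Suc.prems by (simp add: uv algebra_simps power2_eq_square)
  then have "u\<^sup>2 + u * v + v\<^sup>2 = 3 * int p ^ (2 * t)"
    using assms(1) by auto
  then have "int p ^ t dvd u \<and> int p ^ t dvd v" by (rule Suc.IH)
  then show ?case by (simp add: uv mult_dvd_mono)
qed simp

text \<open>The end of the descent. Completing the square bounds both variables by 2 in absolute
  value, which leaves a finite check.\<close>

lemma quadratic_form_eq_3:
  fixes x y :: int
  assumes "x\<^sup>2 + x * y + y\<^sup>2 = 3" "[x = e] (mod 3)" "[y = e] (mod 3)" "e = 1 \<or> e = - 1"
  shows "(x, y) \<in> {(e, e), (e, - 2 * e), (- 2 * e, e)}"
proof -
  have "(2 * x + y)\<^sup>2 + 3 * y\<^sup>2 = 12" "(2 * y + x)\<^sup>2 + 3 * x\<^sup>2 = 12"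
    using assms(1) by (simp_all add: algebra_simps power2_eq_square)
  then have "y\<^sup>2 \<le> 2\<^sup>2" "x\<^sup>2 \<le> 2\<^sup>2"
    using zero_le_power2[of "2 * x + y"] zero_le_power2[of "2 * y + x"]
    unfolding power2_eq_square[of 2] by linarith+
  then have "\<bar>y\<bar> \<le> 2" "\<bar>x\<bar> \<le> 2" using abs_le_square_iff[of _ "2::int"] by simp_all
  then have "x \<in> {-2, -1, 0, 1, 2}" "y \<in> {-2, -1, 0, 1, 2}" by auto
  then show ?thesis using assms by (auto simp: cong_def)
qed

section \<open>The cubic resolvent and the form \<open>a ^ 2 + 27 * b ^ 2\<close>\<close>

text \<open>With \<open>L = x y z / q\<close> the three numbers are the roots of \<open>X\<^sup>3 - 3 q X - q L\<close>.\<close>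

lemma cubic_resolvent_valuations:
  fixes x y z M :: int and p t :: nat
  assumes p: "prime p" and t: "t > 0" and q: "q = int p ^ (3 * t)"
    and e1: "x + y + z = 0" and e2: "x\<^sup>2 + y\<^sup>2 + z\<^sup>2 = 6 * q"
    and e3: "(q - 1) * (x * y * z) = q * (M - q\<^sup>2)" and M: "\<not> int p dvd M"
  shows "\<exists>a b c. x = int p ^ t * a \<and> y = int p ^ t * b \<and> z = int p ^ t * c \<and>
    \<not> int p dvd a * b * c"
proof -
  define s where "s = int p ^ t"
  have s: "q = s ^ 3" "s \<noteq> 0" using p by (simp_all add: s_def q mult.commute power_mult)
  have pq: "int p dvd q" using t by (simp add: q)
  \<comment> \<open>As \<open>q\<close> is prime to \<open>q - 1\<close>, \<open>e3\<close> makes it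
    divide \<open>x * y * z\<close>; the quotient is \<open>L\<close>.\<close>
  have "coprime q (q - 1)" by (metis coprime_commute coprime_diff_one_left)
  moreover have "q dvd (q - 1) * (x * y * z)" by (simp add: e3)
  ultimately have "q dvd x * y * z" by (simp add: coprime_dvd_mult_right_iff)
  then obtain L where L: "x * y * z = q * L" by (auto elim: dvdE)
  have q0: "q \<noteq> 0" using s by simp
  have "q * ((q - 1) * L) = q * (M - q\<^sup>2)" using e3 L by (simp add: algebra_simps)
  then have "M = (q - 1) * L + q\<^sup>2" using q0 by simp
  \<comment> \<open>Modulo \<open>p\<close> this reads \<open>M = - L\<close>, which carries the
    hypothesis on \<open>M\<close> over to the product.\<close>
  then have nL: "\<not> int p dvd L" using M pq by (auto simp: power2_eq_square)
  have root: "s dvd u" if "u \<in> {x, y, z}" for u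
  proof -
    have z: "z = - x - y" using e1 by simp
    have "u ^ 3 = q * (3 * u + L)"
    proof -
      have "3 * q = x\<^sup>2 + x * y + y\<^sup>2"
        using e2 unfolding z by (simp add: power2_eq_square algebra_simps)
      moreover have "u ^ 3 = (x\<^sup>2 + x * y + y\<^sup>2) * u + x * y * z"
        using that unfolding z
        by (elim insertE emptyE; hypsubst) (simp_all add: power2_eq_square power3_eq_cube algebra_simps)
      ultimately have "u ^ 3 = 3 * q * u + x * y * z" by simp
      then show ?thesis using L by (simp add: algebra_simps)
    qed
    \<comment> \<open>\<open>q\<close> is the cube of \<open>s\<close>, and divisibility of cubes
      passes to their bases.\<close>
    then have "s ^ 3 dvd u ^ 3" using s by simp
    then show ?thesis by simp
  qed
  obtain a b c where abc: "x = s * a" "y = s * b" "z = s * c"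
    using root[of x] root[of y] root[of z] by (auto elim!: dvdE)
  have "s ^ 3 * (a * b * c) = s ^ 3 * L"
    using L by (simp add: abc s power3_eq_cube algebra_simps)
  then have "a * b * c = L" using s by simp
  then show ?thesis using abc nL s_def by auto
qed

text \<open>Put \<open>s = p ^ t\<close>. It divides the product of \<open>a * b' - a' * b\<close>
  and \<open>a * b' + a' * b\<close>, while \<open>p\<close> does not divide both, so
  \<open>s\<close> divides one of them. After a change of sign of \<open>b'\<close> it is the first,
  and the composition identity for the form leaves no room for a nonzero multiple of
  \<open>s\<close>.\<close>

lemma representation_unique:
  fixes a b a' b' :: int and p t :: nat
  assumes p: "prime p" "odd p" and t: "t > 0"
    and r: "4 * int p ^ t = a\<^sup>2 + 27 * b\<^sup>2" "4 * int p ^ t = a'\<^sup>2 + 27 * b'\<^sup>2"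
    and one: "[a = 1] (mod 3)" "[a' = 1] (mod 3)" and cop: "coprime a (int p)" "coprime a' (int p)"
  shows "a' = a \<and> (b' = b \<or> b' = - b)"
proof -
  define s where "s = int p ^ t"
  have s: "s > 0" using p by (simp add: s_def prime_gt_0_nat)
  have pp: "prime (int p)" using p by simp
  \<comment> \<open>\<open>d\<close> stands for \<open>b'\<close> or \<open>- b'\<close>; the bound
    \<open>27 * k ^ 2 \<le> 16\<close> forces \<open>k = 0\<close>.\<close>
  have main: "d\<^sup>2 = b\<^sup>2" if sd: "s dvd a * d - a' * b" and rd: "4 * s = a'\<^sup>2 + 27 * d\<^sup>2" for d
  proof -
    obtain k where k: "a * d - a' * b = s * k" using sd by (auto simp: dvd_def)
    have "(4 * s) * (4 * s) = (a\<^sup>2 + 27 * b\<^sup>2) * (a'\<^sup>2 + 27 * d\<^sup>2)"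
      using r(1) rd by (simp add: s_def)
    also have "\<dots> = (a * a' + 27 * b * d)\<^sup>2 + 27 * (a * d - a' * b)\<^sup>2"
      by (simp add: algebra_simps power2_eq_square)
    also have "\<dots> = (a * a' + 27 * b * d)\<^sup>2 + 27 * (s\<^sup>2 * k\<^sup>2)"
      by (simp add: k power_mult_distrib)
    finally have "27 * (s\<^sup>2 * k\<^sup>2) \<le> 16 * s\<^sup>2"
      using zero_le_power2[of "a * a' + 27 * b * d"] by (simp add: power2_eq_square)
    then have "s\<^sup>2 * (27 * k\<^sup>2) \<le> s\<^sup>2 * 16" by (simp add: algebra_simps)
    then have "27 * k\<^sup>2 \<le> 16" using s by simp
    then have "k\<^sup>2 < 1" by simp
    then have "k = 0" using zero_less_power2[of k] by linarith
    then have "a * d = a' * b" using k by simp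
    then have "a\<^sup>2 * d\<^sup>2 = a'\<^sup>2 * b\<^sup>2" by (metis power_mult_distrib)
    moreover have "a\<^sup>2 = 4 * s - 27 * b\<^sup>2" "a'\<^sup>2 = 4 * s - 27 * d\<^sup>2"
      using r(1) rd by (simp_all add: s_def)
    ultimately have "s * d\<^sup>2 = s * b\<^sup>2" by (simp add: algebra_simps)
    then show ?thesis using s by simp
  qed
  have "(a * b' - a' * b) * (a * b' + a' * b) = 4 * s * (b'\<^sup>2 - b\<^sup>2)"
  proof -
    have "(a * b' - a' * b) * (a * b' + a' * b) = a\<^sup>2 * b'\<^sup>2 - a'\<^sup>2 * b\<^sup>2"
      by (simp add: algebra_simps power2_eq_square)
    moreover have "a\<^sup>2 = 4 * s - 27 * b\<^sup>2" "a'\<^sup>2 = 4 * s - 27 * b'\<^sup>2"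
      using r by (simp_all add: s_def)
    ultimately show ?thesis by (simp add: algebra_simps)
  qed
  then have dvd: "s dvd (a * b' - a' * b) * (a * b' + a' * b)" by simp
  \<comment> \<open>If \<open>p\<close> divided both factors, it would divide \<open>b'\<close> and
    then \<open>a'\<close>, against coprimality.\<close>
  have "\<not> (int p dvd a * b' - a' * b \<and> int p dvd a * b' + a' * b)"
  proof
    assume "int p dvd a * b' - a' * b \<and> int p dvd a * b' + a' * b"
    then have "int p dvd (a * b' - a' * b) + (a * b' + a' * b)" by (blast intro: dvd_add)
    then have "int p dvd 2 * a * b'" by (simp add: mult.assoc)
    moreover have "\<not> int p dvd 2"
    proof
      assume "int p dvd 2"
      then have "p dvd 2" by presburger
      then show False using p by (metis dvd_refl primes_dvd_imp_eq two_is_prime_nat)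
    qed
    moreover have "\<not> int p dvd a" using cop pp by (metis coprime_absorb_right not_prime_unit)
    ultimately have "int p dvd b'" using pp by (simp add: prime_dvd_mult_iff)
    then have "int p dvd 4 * int p ^ t - 27 * b'\<^sup>2" using t by (auto simp: power2_eq_square)
    then have "int p dvd a'\<^sup>2" using r(2) by simp
    then have "int p dvd a'" using pp prime_dvd_power by blast
    then show False using cop pp by (metis coprime_absorb_right not_prime_unit)
  qed
  then have "coprime s (a * b' - a' * b) \<or> coprime s (a * b' + a' * b)"
    using pp by (auto simp: s_def intro: prime_imp_coprime)
  then have "s dvd a * b' - a' * b \<or> s dvd a * b' + a' * b"
    using dvd by (metis coprime_dvd_mult_left_iff coprime_dvd_mult_right_iff)
  then have "b'\<^sup>2 = b\<^sup>2"
  proof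
    assume "s dvd a * b' + a' * b"
    then have "s dvd - (a * b' + a' * b)" by (simp only: dvd_minus_iff)
    then have "s dvd a * (- b') - a' * b" by (simp add: algebra_simps)
    then show ?thesis using main[of "- b'"] r by (simp add: s_def)
  qed (use main r s_def in blast)
  then have "b' = b \<or> b' = - b" by (simp_all add: power2_eq_iff)
  moreover have "a'\<^sup>2 = a\<^sup>2" using r \<open>b'\<^sup>2 = b\<^sup>2\<close> by simp
 
ultimately have "a' = a \<or> a' = - a" by (simp add: power2_eq_iff)
  then have "a' = a" using one unfolding cong_def by presburger
  then show ?thesis using \<open>b' = b \<or> b' = - b\<close> by simp
qed

text \<open>Exactly one of the three numbers can serve as \<open>a\<close>: the one for which the other two agree
  modulo 9.\<close>

lemma ex_representation:
  fixes x y z s :: int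
  assumes "x + y + z = 0" "x\<^sup>2 + y\<^sup>2 + z\<^sup>2 = 6 * s"
    and "[x = 1] (mod 3)" "[y = 1] (mod 3)" "[z = 1] (mod 3)"
  shows "\<exists>a b u v. {#a, u, v#} = {#x, y, z#} \<and> 4 * s = a\<^sup>2 + 27 * b\<^sup>2 \<and>
    2 * u = - (a - 9 * b) \<and> 2 * v = - (a + 9 * b)"
proof -
  have *: "\<exists>a b u v. {#a, u, v#} = {#x', y', z'#} \<and> 4 * s = a\<^sup>2 + 27 * b\<^sup>2 \<and>
      2 * u = - (a - 9 * b) \<and> 2 * v = - (a + 9 * b)"
    if "x' + y' + z' = 0" "x'\<^sup>2 + y'\<^sup>2 + z'\<^sup>2 = 6 * s" "\<exists>b. y' - z' = 9 * b" for x' y' z' :: int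
  proof -
    obtain b where b: "y' - z' = 9 * b" using \<open>\<exists>b. y' - z' = 9 * b\<close> by blast
    have x': "x' = - 2 * z' - 9 * b" "y' = z' + 9 * b" using that(1) b by simp_all
    have "4 * s = x'\<^sup>2 + 27 * b\<^sup>2"
      using that(2) unfolding x' by (simp add: algebra_simps power2_eq_square)
    moreover have "2 * y' = - (x' - 9 * b)" "2 * z' = - (x' + 9 * b)" by (simp_all add: x')
    ultimately show ?thesis by blast
  qed
  obtain i j k where ijk: "x = 3 * i + 1" "y = 3 * j + 1" "z = 3 * k + 1"
    using assms(3-5) by (auto simp: cong_iff_dvd_diff algebra_simps elim!: dvdE)
  have "i = - 1 - j - k" using assms(1) ijk by simp
  \<comment> \<open>Three distinct residues modulo 3 would add up to a multiple of 3, but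
    \<open>i\<close>, \<open>j\<close>, \<open>k\<close> add up to \<open>- 1\<close>; so two of
    them agree.\<close>
  then have "(\<exists>b. j - k = 3 * b) \<or> (\<exists>b. k - i = 3 * b) \<or> (\<exists>b. i - j = 3 * b)"
    by presburger
  then consider b where "j - k = 3 * b" | b where "k - i = 3 * b" | b where "i - j = 3 * b"
    by blast
  then consider "\<exists>b. y - z = 9 * b" | "\<exists>b. z - x = 9 * b" | "\<exists>b. x - y = 9 * b"
  proof cases
    case (1 b)
    then have "y - z = 9 * b" using ijk by simp
    then show ?thesis using that by blast
  next
    case (2 b)
    then have "z - x = 9 * b" using ijk by simp
    then show ?thesis using that by blast
  next
    case (3 b)
    then have "x - y = 9 * b" using ijk by simp
    then show ?thesis using that by blast
  qed
  then show ?thesis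
  proof cases
    case 1
    then show ?thesis using *[of x y z] assms(1,2) by blast
  next
    case 2
    then show ?thesis using *[of y z x] assms(1,2) by (simp add: add_ac add_mset_commute)
  next
    case 3
    then show ?thesis using *[of z x y] assms(1,2) by (simp add: add_ac add_mset_commute)
  qed
qed

section \<open>Cubes in a finite field\<close>

lemma finite_field_power_card:
  fixes x :: "'a::{field,finite}"
  shows "x ^ CARD('a) = x"
proof (cases "x = 0")
  case False
  have "x * (\<Prod>y\<in>UNIV-{0}. x * y) = x * x ^ (CARD('a) - 1) * \<Prod>(UNIV-{0})"
    by (simp add: prod.distrib mult_ac)
  also have "x * x ^ (CARD('a) - 1) = x ^ Suc (CARD('a) - 1)"
    by (subst power_Suc) auto
  also have "Suc (CARD('a) - 1) = CARD('a)"
    using finite_UNIV_card_ge_0[where ?'a = 'a] by simp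
  \<comment> \<open>Multiplication by a nonzero \<open>x\<close> permutes the nonzero
    elements.\<close>
  also have "(\<Prod>y\<in>UNIV-{0}. x * y) = (\<Prod>y\<in>UNIV-{0}. y)"
    by (rule prod.reindex_bij_witness[of _ "\<lambda>y. y / x" "\<lambda>y. x * y"]) (use False in auto)
  finally show ?thesis
    by simp
qed (use finite_UNIV_card_ge_0[where ?'a = 'a] in auto)

lemma finite_field_power_card_minus_1:
  fixes x :: "'a::{field,finite}"
  assumes "x \<noteq> 0"
  shows "x ^ (CARD('a) - 1) = 1"
proof -
  have "x * x ^ (CARD('a) - 1) = x * 1"
    using finite_field_power_card[of x] finite_UNIV_card_ge_0[where ?'a = 'a]
    by (simp flip: power_Suc)
  then show ?thesis using assms by simp
qed

lemma card_power_eq_le: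
  fixes c :: "'a::field"
  assumes "k > 0"
  shows "card {x. x ^ k = c} \<le> k" "finite {x. x ^ k = c}"
proof -
  have d: "degree (monom 1 k + [:- c:]) = k"
    using assms by (simp add: degree_add_eq_left degree_monom_eq)
  then have nz: "monom 1 k + [:- c:] \<noteq> 0" using assms by force
  have "{x. x ^ k = c} = {x. poly (monom 1 k + [:- c:]) x = 0}" by (simp add: poly_monom)
  then show "card {x. x ^ k = c} \<le> k" "finite {x. x ^ k = c}"
    using card_poly_roots_bound[OF nz] poly_roots_finite[OF nz] d by metis+
qed

text \<open>Otherwise \<open>X ^ k - 1\<close> would have more roots than its degree. Such elements
  do the work of a generator of the multiplicative group.\<close>

lemma ex_power_neq_1:
  assumes "k > 0" "k < CARD('a::{field,finite}) - 1"
  shows "\<exists>x::'a. x \<noteq> 0 \<and> x ^ k \<noteq> 1"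
proof (rule ccontr)
  assume "\<not> ?thesis"
  then have "UNIV - {0 :: 'a} \<subseteq> {x. x ^ k = 1}" by auto
  then have "CARD('a) - 1 \<le> card {x::'a. x ^ k = 1}"
    using card_mono[of "{x::'a. x ^ k = 1}" "UNIV - {0}"] by simp
  then show False using card_power_eq_le(1)[of k "1::'a"] assms by linarith
qed

text \<open>Replacing \<open>x\<close> by \<open>g * x\<close> multiplies the sum by
  \<open>g ^ k\<close>, so it vanishes if \<open>g ^ k\<close> differs from 1 for some nonzero
  \<open>g\<close>. For \<open>k = 0\<close> the convention \<open>0 ^ 0 = 1\<close> makes every
  term 1, and the field size is zero in the field.\<close>

lemma finite_field_power_sum:
  fixes k :: nat
  shows "(\<Sum>x\<in>(UNIV::'a::{field,finite} set). x ^ k) =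
    (if k > 0 \<and> (CARD('a) - 1) dvd k then - 1 else 0)"
proof -
  have c0: "of_nat CARD('a) = (0::'a)"
  proof -
    have "(\<Sum>x\<in>(UNIV::'a set). x) = (\<Sum>x\<in>UNIV. x + 1)"
      by (rule sum.reindex_bij_witness[of _ "\<lambda>x. x + 1" "\<lambda>x. x - 1"]) auto
    then show ?thesis by (simp add: sum.distrib)
  qed
  consider "k = 0" | "k > 0" "(CARD('a) - 1) dvd k" | "\<not> (CARD('a) - 1) dvd k" by auto
  then show ?thesis
  proof cases
    case 1
    then show ?thesis using c0 by simp
  next
    case 2
    then obtain j where j: "k = (CARD('a) - 1) * j" by blast
    have "x ^ k = (if x = 0 then 0 else 1)" for x :: 'a
      using \<open>k > 0\<close> unfolding j power_mult
      by (auto simp: finite_field_power_card_minus_1[of x] simp del: One_nat_def)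
    then have "(\<Sum>x\<in>(UNIV::'a set). x ^ k) = (\<Sum>x\<in>(UNIV::'a set). 1 - (if x = 0 then 1 else 0))"
      by (intro sum.cong) auto
    also have "\<dots> = - 1" using c0 by (simp add: sum_subtractf)
    finally show ?thesis using 2 by simp
  next
    case 3
    define r where "r = k mod (CARD('a) - 1)"
    have C: "CARD('a) - 1 > 0"
      using card_mono[of "UNIV::'a set" "{0, 1}"] by simp
    then have r: "r > 0" "r < CARD('a) - 1"
      using 3 by (auto simp: r_def dvd_eq_mod_eq_0 simp del: One_nat_def)
    have pr: "x ^ k = x ^ r" if "x \<noteq> 0" for x :: 'a
    proof -
      have "x ^ k = x ^ ((CARD('a) - 1) * (k div (CARD('a) - 1)) + r)"
        unfolding r_def by simp
      then show ?thesis
        unfolding power_add power_mult finite_field_power_card_minus_1[OF that] by simp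
    qed
    obtain g :: 'a where g: "g \<noteq> 0" "g ^ r \<noteq> 1" using ex_power_neq_1[OF r] by blast
    have "(\<Sum>x\<in>(UNIV::'a set). x ^ k) = (\<Sum>x\<in>UNIV. (g * x) ^ k)"
      by (rule sum.reindex_bij_witness[of _ "\<lambda>x. g * x" "\<lambda>x. x / g"]) (use g in auto)
    also have "\<dots> = g ^ r * (\<Sum>x\<in>UNIV. x ^ k)"
      by (simp add: power_mult_distrib sum_distrib_left pr[OF g(1)])
    finally have "(1 - g ^ r) * (\<Sum>x\<in>(UNIV::'a set). x ^ k) = 0" by (simp add: algebra_simps)
    then show ?thesis using g 3 by simp
  qed
qed


section \<open>Cubes, their fibres and their cosets\<close>

lemma nontrivial_cube_root:
  assumes n: "CARD('a::{field,finite}) - 1 = 3 * n"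
  obtains g :: "'a::{field,finite}" where "g \<noteq> 0" "g ^ n \<noteq> 1" "(g ^ n) ^ 3 = 1" "1 + g ^ n + (g ^ n)\<^sup>2 = 0"
proof -
  have "CARD('a) - 1 > 0"
    using card_mono[of "UNIV::'a set" "{0, 1}"] by simp
  \<comment> \<open>Such a \<open>g\<close> is not a cube, and \<open>1\<close>, \<open>g\<close>,
    \<open>g ^ 2\<close> will represent the cosets of the cubes; \<open>g ^ n\<close> is a primitive
    cube root of unity.\<close>
  then obtain g :: 'a where g: "g \<noteq> 0" "g ^ n \<noteq> 1"
    using ex_power_neq_1[of n, where 'a = 'a] n by fastforce
  have c: "(g ^ n) ^ 3 = 1"
    using finite_field_power_card_minus_1[OF g(1)] n by (simp add: mult.commute flip: power_mult)
  have "(g ^ n - 1) * (1 + g ^ n + (g ^ n)\<^sup>2) = (g ^ n) ^ 3 - 1"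
    by (simp add: algebra_simps power2_eq_square power3_eq_cube)
  then show thesis using that g c by simp
qed

text \<open>The fibre consists of \<open>c\<close> times the three cube roots of unity; the degree
  bound excludes more.\<close>

lemma card_cube_fibre:
  fixes c :: "'a::{field,finite}"
  assumes n: "CARD('a) - 1 = 3 * n" and c: "c \<noteq> 0"
  shows "card {x. x ^ 3 = c ^ 3} = 3"
proof -
  obtain g :: 'a where g: "g \<noteq> 0" "g ^ n \<noteq> 1" "(g ^ n) ^ 3 = 1" "1 + g ^ n + (g ^ n)\<^sup>2 = 0"
    using nontrivial_cube_root[OF n] by blast
  define w where "w = g ^ n"
  have w: "w \<noteq> 0" "w \<noteq> 1" "w ^ 3 = 1" using g by (simp_all add: w_def)
  then have w2: "w\<^sup>2 \<noteq> 1" "w\<^sup>2 \<noteq> w" by (auto simp: power2_eq_square power3_eq_cube)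
  have "(w\<^sup>2) ^ 3 = 1" using w(3) by (metis power_mult mult.commute power_one)
  then have "{c, c * w, c * w\<^sup>2} \<subseteq> {x. x ^ 3 = c ^ 3}"
    using w by (simp add: power_mult_distrib)
  moreover have "card {c, c * w, c * w\<^sup>2} = 3"
  proof -
    have "c \<noteq> c * w" "c \<noteq> c * w\<^sup>2" "c * w \<noteq> c * w\<^sup>2"
      using c w w2 by auto
    then show ?thesis by simp
  qed
  ultimately have "3 \<le> card {x. x ^ 3 = c ^ 3}"
    using card_mono[of "{x. x ^ 3 = c ^ 3}" "{c, c * w, c * w\<^sup>2}"] by simp
  moreover have "card {x. x ^ 3 = c ^ 3} \<le> 3" by (rule card_power_eq_le) simp
  ultimately show ?thesis by simp
qed

lemma sum_cubes:
  fixes f :: "'a::{field,finite} \<Rightarrow> 'b::comm_semiring_1"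
  assumes n: "CARD('a) - 1 = 3 * n"
  shows "(\<Sum>x\<in>UNIV. f (x ^ 3)) = f 0 + 3 * (\<Sum>s\<in>power_residues 3. f s)"
proof -
  have "(\<Sum>x\<in>UNIV - {0}. f (x ^ 3)) =
      (\<Sum>s\<in>(\<lambda>x. x ^ 3) ` (UNIV - {0}). \<Sum>x\<in>{x \<in> UNIV - {0}. x ^ 3 = s}. f (x ^ 3))"
    by (rule sum.image_gen) simp
  also have "\<dots> = (\<Sum>s\<in>(\<lambda>x. x ^ 3) ` (UNIV - {0}). 3 * f s)"
  proof (rule sum.cong[OF refl])
    fix s :: 'a assume "s \<in> (\<lambda>x. x ^ 3) ` (UNIV - {0})"
    then obtain c where c: "c \<noteq> 0" "s = c ^ 3" by auto
    then have "{x \<in> UNIV - {0}. x ^ 3 = s} = {x. x ^ 3 = c ^ 3}" by auto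
    then have "card {x \<in> UNIV - {0}. x ^ 3 = s} = 3" using card_cube_fibre[OF n c(1)] by simp
    moreover have "(\<Sum>x\<in>{x \<in> UNIV - {0}. x ^ 3 = s}. f (x ^ 3)) =
        (\<Sum>x\<in>{x \<in> UNIV - {0}. x ^ 3 = s}. f s)" by simp
    ultimately show "(\<Sum>x\<in>{x \<in> UNIV - {0}. x ^ 3 = s}. f (x ^ 3)) = 3 * f s"
      by simp
  qed
  also have "(\<lambda>x. x ^ 3) ` (UNIV - {0}) = (power_residues 3 :: 'a set)"
    by (auto simp: power_residues_def)
  finally have "(\<Sum>x\<in>UNIV - {0}. f (x ^ 3)) = 3 * (\<Sum>s\<in>power_residues 3. f s)"
    by (simp add: sum_distrib_left)
  then show ?thesis by (simp add: sum.remove[of UNIV 0])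
qed

lemma card_power_residues_3:
  assumes n: "CARD('a::{field,finite}) - 1 = 3 * n"
  shows "card (power_residues 3 :: 'a set) = n"
proof -
  have "CARD('a) = 1 + 3 * card (power_residues 3 :: 'a set)"
    using sum_cubes[OF n, of "\<lambda>_. 1 :: nat"] by simp
  then show ?thesis using n by simp
qed

text \<open>Euler's criterion for cubes: the cubes are among the roots of \<open>X ^ n - 1\<close>,
  and there are \<open>n\<close> cubes and at most \<open>n\<close> roots.\<close>

lemma power_residues_3_eq:
  assumes n: "CARD('a::{field,finite}) - 1 = 3 * n"
  shows "(power_residues 3 :: 'a set) = {x. x ^ n = 1}"
proof (rule card_subset_eq)
  show sub: "(power_residues 3 :: 'a set) \<subseteq> {x. x ^ n = 1}"
  proof
    fix s :: 'a assume "s \<in> power_residues 3"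
    then obtain x where x: "x \<noteq> 0" "s = x ^ 3" by (auto simp: power_residues_def)
    then have "s ^ n = x ^ (3 * n)" by (simp add: power_mult)
    then show "s \<in> {x. x ^ n = 1}" using finite_field_power_card_minus_1[OF x(1)] n by simp
  qed
  have "n > 0" using n card_mono[of "UNIV::'a set" "{0, 1}"] by (cases n) simp_all
  then have "card {x::'a. x ^ n = 1} \<le> n" by (rule card_power_eq_le)
  moreover have "card (power_residues 3 :: 'a set) \<le> card {x::'a. x ^ n = 1}"
    using sub by (intro card_mono) simp_all
  ultimately show "card (power_residues 3 :: 'a set) = card {x::'a. x ^ n = 1}"
    using card_power_residues_3[OF n] by simp
qed simp

text \<open>For nonzero \<open>u\<close> the power \<open>w = u ^ n\<close> is a cube root of unity,
  and \<open>1 + w + w ^ 2\<close> is 3 or 0 according to whether \<open>w = 1\<close>. The equation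
  holds in the field, so it gives the count modulo the characteristic.\<close>

lemma card_cube_fibre_eq:
  fixes u :: "'a::{field,finite}"
  assumes n: "CARD('a) - 1 = 3 * n"
  shows "of_nat (card {x. x ^ 3 = u}) = 1 + u ^ n + u ^ (2 * n)"
proof -
  have "n > 0" using n card_mono[of "UNIV::'a set" "{0, 1}"] by (cases n) simp_all
  consider "u = 0" | "u \<in> power_residues 3" | "u \<noteq> 0" "u \<notin> power_residues 3" by blast
  then show ?thesis
  proof cases
    case 1
    then show ?thesis using \<open>n > 0\<close> by (simp add: power_0_left)
  next
    case 2
    then obtain c where c: "c \<noteq> 0" "u = c ^ 3" by (auto simp: power_residues_def)
    moreover have "u ^ n = 1" using 2 by (simp add: power_residues_3_eq[OF n])
    ultimately show ?thesis
      using card_cube_fibre[OF n c(1)] by (simp add: mult.commute[of 2] power_mult)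
  next
    case 3
    then have un: "u ^ n \<noteq> 1" by (simp add: power_residues_3_eq[OF n])
    have "(u ^ n) ^ 3 = 1"
      using finite_field_power_card_minus_1[OF 3(1)] n by (simp add: mult.commute flip: power_mult)
    then have "(u ^ n - 1) * (1 + u ^ n + u ^ (2 * n)) = 0"
      by (simp only: mult_2 power_add) (simp add: algebra_simps power3_eq_cube)
    then have "1 + u ^ n + u ^ (2 * n) = 0" using un by simp
    moreover have "{x. x ^ 3 = u} = {}" using 3 by (auto simp: power_residues_def)
    ultimately show ?thesis by simp
  qed
qed

text \<open>The power \<open>x ^ n\<close> takes three different values on the three cosets, which
  separates them; counting shows that they exhaust the nonzero elements.\<close>

lemma power_residues_3_cosets:
  assumes n: "CARD('a::{field,finite}) - 1 = 3 * n"
    and g: "(g::'a) \<noteq> 0" "g ^ n \<noteq> 1"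
  defines "S \<equiv> power_residues 3"
  shows "UNIV - {0} = S \<union> (*) g ` S \<union> (*) (g\<^sup>2) ` S"
    and "S \<inter> (*) g ` S = {}" "(S \<union> (*) g ` S) \<inter> (*) (g\<^sup>2) ` S = {}"
proof -
  have S: "S = {x. x ^ n = 1}" by (simp add: S_def power_residues_3_eq[OF n])
  have n0: "n > 0" using n card_mono[of "UNIV::'a set" "{0, 1}"] by (cases n) simp_all
  have c: "(g ^ n) ^ 3 = 1"
    using finite_field_power_card_minus_1[OF g(1)] n by (simp add: mult.commute flip: power_mult)
  have g2: "g ^ n * g ^ n \<noteq> 1" "g ^ n * g ^ n \<noteq> g ^ n"
    using c g by (auto simp: power3_eq_cube)
  show d: "S \<inter> (*) g ` S = {}" "(S \<union> (*) g ` S) \<inter> (*) (g\<^sup>2) ` S = {}"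
    using g g2 by (auto simp: S power_mult_distrib power2_eq_square)
  have "card ((*) g ` S) = n" "card ((*) (g\<^sup>2) ` S) = n"
    using g card_power_residues_3[OF n] by (subst card_image; auto simp: S_def inj_on_def)+
  then have "card (S \<union> (*) g ` S \<union> (*) (g\<^sup>2) ` S) = card (UNIV - {0::'a})"
    using d card_power_residues_3[OF n] n by (simp add: card_Un_disjoint S_def)
  moreover have "S \<union> (*) g ` S \<union> (*) (g\<^sup>2) ` S \<subseteq> UNIV - {0}"
    using g n0 by (auto simp: S power_0_left)
  ultimately show "UNIV - {0} = S \<union> (*) g ` S \<union> (*) (g\<^sup>2) ` S"
    by (intro card_subset_eq[symmetric]) simp_all
qed

lemma sum_cube_cosets:
  fixes f :: "'a::{field,finite} \<Rightarrow> 'b::comm_semiring_1"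
  assumes n: "CARD('a) - 1 = 3 * n" and g: "g \<noteq> 0" "g ^ n \<noteq> 1"
    and f: "\<And>y s. s \<in> power_residues 3 \<Longrightarrow> f (y * s) = f y"
  shows "(\<Sum>y\<in>UNIV. f y) = f 0 + of_nat n * (f 1 + f g + f (g\<^sup>2))"
proof -
  define S :: "'a set" where "S = power_residues 3"
  note cos = power_residues_3_cosets[OF n g, folded S_def]
  have S: "(\<Sum>y\<in>(*) c ` S. f y) = of_nat n * f c" if "c \<noteq> 0" for c
  proof -
    have "(\<Sum>y\<in>(*) c ` S. f y) = (\<Sum>s\<in>S. f (c * s))"
      using that by (subst sum.reindex) (auto simp: inj_on_def)
    also have "\<dots> = (\<Sum>s\<in>S. f c)" by (intro sum.cong) (auto simp: S_def f)
    finally show ?thesis using card_power_residues_3[OF n] by (simp add: S_def)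
  qed
  have "(\<Sum>y\<in>UNIV. f y) = f 0 + (\<Sum>y\<in>UNIV - {0}. f y)" by (simp add: sum.remove[of UNIV 0])
  also have "(\<Sum>y\<in>UNIV - {0}. f y) = (\<Sum>y\<in>(*) 1 ` S. f y) + (\<Sum>y\<in>(*) g ` S. f y) + (\<Sum>y\<in>(*) (g\<^sup>2) ` S. f y)"
    unfolding cos(1) using cos(2,3) by (simp add: sum.union_disjoint)
  also have "\<dots> = of_nat n * (f 1 + f g + f (g\<^sup>2))"
    using g by (subst (1 2 3) S) (auto simp: algebra_simps)
  finally show ?thesis .
qed

text \<open>Given \<open>x\<close> and \<open>y\<close>, the number of \<open>z\<close> is
  \<open>1 + u ^ n + u ^ (2 * n)\<close> in the field, with \<open>u = - (x ^ 3 + y ^ 3)\<close>.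
  After binomial expansion a monomial contributes only if both exponents are positive multiples of
  \<open>3 * n\<close>. This happens once, for \<open>x ^ (3 * n) * y ^ (3 * n)\<close>.\<close>

lemma card_triple_cube_zeros:
  assumes n: "CARD('a::{field,finite}) - 1 = 3 * n" and "even n"
  shows "of_nat (card {(x::'a, y, z). x ^ 3 + y ^ 3 + z ^ 3 = 0}) = (of_nat (2 * n choose n) :: 'a)"
proof -
  have n0: "n > 0" using n card_mono[of "UNIV::'a set" "{0, 1}"] by (cases n) simp_all
  have ps: "(\<Sum>x\<in>(UNIV::'a set). x ^ (3 * i)) = (if i > 0 \<and> n dvd i then - 1 else 0)" for i
    using finite_field_power_sum[of "3 * i", where 'a = 'a] unfolding n by simp
  have expand: "(\<Sum>x\<in>(UNIV::'a set). \<Sum>y\<in>(UNIV::'a set). (x ^ 3 + y ^ 3) ^ k) =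
      (\<Sum>i\<le>k. if i > 0 \<and> n dvd i \<and> k - i > 0 \<and> n dvd k - i then of_nat (k choose i) else 0)" for k
  proof -
    have "(\<Sum>x\<in>(UNIV::'a set). \<Sum>y\<in>(UNIV::'a set). (x ^ 3 + y ^ 3) ^ k) =
        (\<Sum>x\<in>(UNIV::'a set). \<Sum>y\<in>(UNIV::'a set). \<Sum>i\<le>k. of_nat (k choose i) * (x ^ (3 * i) * y ^ (3 * (k - i))))"
      by (simp add: binomial_ring mult.assoc flip: power_mult)
    also have "\<dots> = (\<Sum>x\<in>(UNIV::'a set). \<Sum>i\<le>k. \<Sum>y\<in>(UNIV::'a set). of_nat (k choose i) * (x ^ (3 * i) * y ^ (3 * (k - i))))"
      by (rule sum.cong[OF refl], rule sum.swap)
    also have "\<dots> = (\<Sum>i\<le>k. \<Sum>x\<in>(UNIV::'a set). \<Sum>y\<in>(UNIV::'a set). of_nat (k choose i) * (x ^ (3 * i) * y ^ (3 * (k - i))))"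
      by (rule sum.swap)
    also have "\<dots> = (\<Sum>i\<le>k. of_nat (k choose i) *
        ((\<Sum>x\<in>(UNIV::'a set). x ^ (3 * i)) * (\<Sum>y\<in>(UNIV::'a set). y ^ (3 * (k - i)))))"
      by (simp only: sum_product) (simp only: sum_distrib_left)
    also have "\<dots> = (\<Sum>i\<le>k. if i > 0 \<and> n dvd i \<and> k - i > 0 \<and> n dvd k - i then of_nat (k choose i) else 0)"
      unfolding ps by (intro sum.cong) auto
    finally show ?thesis .
  qed
  have "{(x::'a, y, z). x ^ 3 + y ^ 3 + z ^ 3 = 0} =
      (SIGMA x:UNIV. SIGMA y:UNIV. {z. z ^ 3 = - (x ^ 3 + y ^ 3)})"
    by (auto simp only: add_eq_0_iff mem_Collect_eq mem_Sigma_iff UNIV_I)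
  then have "of_nat (card {(x::'a, y, z). x ^ 3 + y ^ 3 + z ^ 3 = 0}) =
      (\<Sum>x\<in>(UNIV::'a set). \<Sum>y\<in>(UNIV::'a set). of_nat (card {z. z ^ 3 = - (x ^ 3 + y ^ 3)}) :: 'a)"
    by simp
  \<comment> \<open>Evenness of \<open>n\<close> removes the minus sign from
    \<open>u\<close>.\<close>
  also have "\<dots> = (\<Sum>x\<in>(UNIV::'a set). \<Sum>y\<in>(UNIV::'a set). (x ^ 3 + y ^ 3) ^ 0 + (x ^ 3 + y ^ 3) ^ n + (x ^ 3 + y ^ 3) ^ (2 * n))"
    using \<open>even n\<close> by (subst card_cube_fibre_eq[OF n]) (simp del: minus_add_distrib add_uminus_conv_diff)
  also have "\<dots> = (\<Sum>x\<in>(UNIV::'a set). \<Sum>y\<in>(UNIV::'a set). (x ^ 3 + y ^ 3) ^ 0) +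
      (\<Sum>x\<in>(UNIV::'a set). \<Sum>y\<in>(UNIV::'a set). (x ^ 3 + y ^ 3) ^ n) +
      (\<Sum>x\<in>(UNIV::'a set). \<Sum>y\<in>(UNIV::'a set). (x ^ 3 + y ^ 3) ^ (2 * n))"
    by (simp only: sum.distrib)
  also have "(\<Sum>x\<in>(UNIV::'a set). \<Sum>y\<in>(UNIV::'a set). (x ^ 3 + y ^ 3) ^ 0) = 0"
    by (simp only: expand) simp
  also have "(\<Sum>x\<in>(UNIV::'a set). \<Sum>y\<in>(UNIV::'a set). (x ^ 3 + y ^ 3) ^ n) = 0"
  proof -
    have "\<not> (i > 0 \<and> n dvd i \<and> n - i > 0)" if "i \<le> n" for i
      using that by (auto dest: dvd_imp_le)
    then show ?thesis unfolding expand by (intro sum.neutral) auto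
  qed
  also have "(\<Sum>x\<in>(UNIV::'a set). \<Sum>y\<in>(UNIV::'a set). (x ^ 3 + y ^ 3) ^ (2 * n)) =
      (\<Sum>i\<le>2 * n. if i = n then of_nat (2 * n choose n) else 0)"
  proof -
    have "i > 0 \<and> n dvd i \<and> 2 * n - i > 0 \<and> n dvd 2 * n - i \<longleftrightarrow> i = n" if "i \<le> 2 * n" for i
    proof
      assume *: "i > 0 \<and> n dvd i \<and> 2 * n - i > 0 \<and> n dvd 2 * n - i"
      then have "n \<le> i" "n \<le> 2 * n - i" by (auto dest: dvd_imp_le)
      then show "i = n" using that by simp
    qed (use n0 in auto)
    then show ?thesis unfolding expand by (intro sum.cong) auto
  qed
  finally show ?thesis by simp
qed

section \<open>Additive characters and cubic periods\<close>

lemma CHAR_eq_prime: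
  assumes "prime p" "CARD('a::{field,finite}) = p ^ m"
  shows "CHAR('a) = p"
proof -
  have "CHAR('a) > 0" by (rule finite_imp_CHAR_pos) simp
  then have pr: "prime CHAR('a)" by (rule prime_CHAR_semidom)
  \<comment> \<open>The exponent 0 makes this a sum of ones: the field size vanishes in the
    field.\<close>
  have "(\<Sum>x\<in>(UNIV::'a set). x ^ 0) = 0" by (subst finite_field_power_sum) simp
  then have "of_nat CARD('a) = (0::'a)" by simp
  then have "CHAR('a) dvd p ^ m" by (simp only: assms(2) of_nat_eq_0_iff_char_dvd)
  then have "CHAR('a) dvd p" using pr prime_dvd_power by blast
  then show ?thesis using pr assms(1) by (simp add: primes_dvd_imp_eq)
qed

text \<open>\<open>X ^ p - X\<close> has at most \<open>p\<close> roots, and additivity of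
  \<open>p\<close>-th powers shows by induction that the \<open>p\<close> multiples of 1 are
  roots.\<close>

lemma prime_subfield_eq:
  assumes "prime p" "CHAR('a::field) = p"
  shows "{c::'a. c ^ p = c} = of_nat ` {..<p}"
proof (rule card_subset_eq[symmetric])
  define P :: "'a poly" where "P = monom 1 p + [:0, - 1:]"
  have "degree P = p"
    using prime_gt_1_nat[OF assms(1)] by (simp add: P_def degree_add_eq_left degree_monom_eq)
  then have P: "P \<noteq> 0" "degree P = p" using prime_gt_0_nat[OF assms(1)] by auto
  have r: "{c::'a. c ^ p = c} = {c. poly P c = 0}" by (simp add: P_def poly_monom)
  show "finite {c::'a. c ^ p = c}" unfolding r by (rule poly_roots_finite[OF P(1)])
  show sub: "of_nat ` {..<p} \<subseteq> {c::'a. c ^ p = c}"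
  proof -
    have "(of_nat j :: 'a) ^ p = of_nat j" for j
    proof (induction j)
      case 0
      then show ?case using prime_gt_0_nat[OF assms(1)] by (simp add: power_0_left)
    next
      case (Suc j)
      have "(1 + of_nat j :: 'a) ^ p = 1 ^ p + of_nat j ^ p"
        by (rule freshmans_dream) (simp_all add: assms)
      then show ?case using Suc by simp
    qed
    then show ?thesis by auto
  qed
  have "inj_on (of_nat :: nat \<Rightarrow> 'a) {..<p}"
    by (rule inj_onI) (auto simp: of_nat_eq_iff_cong_CHAR assms(2) cong_def)
  then have "card (of_nat ` {..<p} :: 'a set) = p" by (simp add: card_image)
  moreover have "card {c::'a. c ^ p = c} \<le> p"
    unfolding r using card_poly_roots_bound[OF P(1)] P(2) by simp
  moreover have "card (of_nat ` {..<p} :: 'a set) \<le> card {c::'a. c ^ p = c}"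
    using sub \<open>finite {c::'a. c ^ p = c}\<close> by (rule card_mono[rotated])
  ultimately show "card (of_nat ` {..<p} :: 'a set) = card {c::'a. c ^ p = c}" by simp
qed

text \<open>The functional is the trace \<open>x + x ^ p + \<dots> + x ^ (p ^ (m - 1))\<close> to the prime field.\<close>

lemma ex_trace:
  assumes p: "prime p" and card: "CARD('a::{field,finite}) = p ^ m"
  shows "\<exists>T :: 'a::{field,finite} \<Rightarrow> 'a. (\<forall>x y. T (x + y) = T x + T y) \<and> range T \<subseteq> of_nat ` {..<p} \<and> (\<exists>x. T x \<noteq> 0)"
proof -
  note C = CHAR_eq_prime[OF p card]
  define T where "T x = (\<Sum>i<m. x ^ (p ^ i))" for x :: 'a
  have pC: "prime CHAR('a)" using p C by simp
  have "T (x + y) = T x + T y" for x y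
    unfolding T_def sum.distrib[symmetric]
    by (intro sum.cong refl freshmans_dream'[OF pC]) (simp add: C)
  moreover have "range T \<subseteq> of_nat ` {..<p}"
  proof -
    have "T x ^ p = T x" for x
    proof -
      have "T x ^ p = (\<Sum>i<m. (x ^ (p ^ i)) ^ p)"
        unfolding T_def by (rule freshmans_dream_sum[OF pC]) (simp add: C)
      also have "\<dots> = (\<Sum>i<m. x ^ (p ^ Suc i))"
        by (simp add: mult.commute flip: power_mult)
      \<comment> \<open>Adding \<open>x\<close> completes the sum to \<open>m + 1\<close> terms. Its
        last term is \<open>x ^ (p ^ m) = x\<close> and the others form \<open>T x\<close>.\<close>
      also have "x + \<dots> = (\<Sum>i<Suc m. x ^ (p ^ i))"
        by (simp only: sum.lessThan_Suc_shift) simp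
      also have "\<dots> = T x + x"
        using finite_field_power_card[of x] by (simp add: T_def card)
      finally show ?thesis by (simp add: add.commute)
    qed
    then show ?thesis unfolding prime_subfield_eq[OF p C, symmetric] by auto
  qed
  moreover have "\<exists>x. T x \<noteq> 0"
  proof (rule ccontr)
    assume "\<not> ?thesis"
    then have T0: "T x = 0" for x by blast
    have m: "m > 0" using card card_mono[of "UNIV::'a set" "{0, 1}"] by (cases m) simp_all
    \<comment> \<open>As a polynomial the trace is nonzero of degree at most
      \<open>p ^ (m - 1)\<close>, too small to vanish on all \<open>p ^ m\<close> elements.\<close>
    define P :: "'a poly" where "P = (\<Sum>i<m. monom 1 (p ^ i))"
    have "coeff P 1 = (\<Sum>i<m. if i = 0 then 1 else 0)"
      unfolding P_def coeff_sum
      by (intro sum.cong) (use prime_gt_1_nat[OF p] in \<open>auto simp: power_eq_1_iff\<close>)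
    then have "coeff P 1 = 1" using m by simp
    then have P: "P \<noteq> 0" by auto
    have "degree P \<le> p ^ (m - 1)"
      unfolding P_def
    proof (rule degree_sum_le)
      fix i assume "i \<in> {..<m}"
      then have "p ^ i \<le> p ^ (m - 1)"
        using prime_gt_0_nat[OF p] by (intro power_increasing) auto
      then show "degree (monom (1::'a) (p ^ i)) \<le> p ^ (m - 1)"
        using degree_monom_le le_trans by blast
    qed simp
    moreover have "{x. poly P x = 0} = UNIV"
      using T0 by (simp add: P_def poly_sum poly_monom T_def)
    then have "p ^ m \<le> degree P" using card_poly_roots_bound[OF P] card by simp
    moreover have "p ^ (m - 1) < p ^ m"
      using m prime_gt_1_nat[OF p] by (intro power_strict_increasing) auto
    ultimately show False by simp
  qed
  ultimately show ?thesis by blast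
qed

text \<open>The values of \<open>\<psi>\<close> on a set \<open>A\<close> closed under the prime field's units are equidistributed
  over the nontrivial \<open>p\<close>-th roots of unity, which add up to \<open>- 1\<close>.\<close>

lemma ex_additive_character:
  assumes p: "prime p" and card: "CARD('a::{field,finite}) = p ^ m"
  shows "\<exists>\<psi> :: 'a::{field,finite} \<Rightarrow> complex. (\<forall>x y. \<psi> (x + y) = \<psi> x * \<psi> y) \<and> (\<forall>x. cmod (\<psi> x) = 1) \<and>
    (\<exists>x. \<psi> x \<noteq> 1) \<and>
    (\<forall>A. (\<forall>j\<in>{1..<p}. \<forall>x\<in>A. of_nat j * x \<in> A) \<longrightarrow> (\<Sum>x\<in>A. \<psi> x) \<in> \<int>)"
proof -
  note C = CHAR_eq_prime[OF p card]
  obtain T :: "'a \<Rightarrow> 'a" where T: "\<And>x y. T (x + y) = T x + T y" "range T \<subseteq> of_nat ` {..<p}" "\<exists>x. T x \<noteq> 0"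
    using ex_trace[OF p card] by blast
  have p1: "p > 1" using p by (rule prime_gt_1_nat)
  \<comment> \<open>\<open>\<tau> x\<close> lifts the trace of \<open>x\<close> to its
    representative below \<open>p\<close>.\<close>
  define \<tau> where "\<tau> x = (SOME j. j < p \<and> of_nat j = T x)" for x
  have \<tau>: "\<tau> x < p" "of_nat (\<tau> x) = T x" for x
  proof -
    have "\<exists>j. j < p \<and> of_nat j = T x" 
    proof -
      have "T x \<in> of_nat ` {..<p}" using T(2) by blast
      then show ?thesis by auto
    qed
    then show "\<tau> x < p" "of_nat (\<tau> x) = T x" unfolding \<tau>_def by (rule someI2_ex, simp)+
  qed
  define r where "r k = cis (2 * pi * real k / real p)" for k
  have r_add: "r (j + k) = r j * r k" for j k
    by (simp add: r_def cis_mult algebra_simps add_divide_distrib)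
  have r_0: "r 0 = 1" by (simp add: r_def)
  have r_p: "r (p * k) = 1" for k
  proof -
    have "2 * pi * real (p * k) / real p = 2 * pi * real k" using p1 by simp
    then show ?thesis by (simp only: r_def cis_multiple_2pi Ints_of_nat)
  qed
  have r_mod: "r (k mod p) = r k" for k
    using r_add[of "p * (k div p)" "k mod p"] by (simp add: r_p)
  have bij: "bij_betw r {..<p} {z. z ^ p = 1}"
    using Complex.bij_betw_roots_unity[of p] p1 by (simp add: r_def[abs_def])
  have r_sum: "(\<Sum>j<p. r j) = 0"
    using sum.reindex_bij_betw[OF bij, of "\<lambda>z. z"] sum_roots_unity[OF p1] by simp
  define \<psi> where "\<psi> x = r (\<tau> x)" for x
  have add: "\<psi> (x + y) = \<psi> x * \<psi> y" for x y
  proof -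
    have "(of_nat (\<tau> (x + y)) :: 'a) = of_nat (\<tau> x + \<tau> y)" by (simp add: \<tau> T)
    then have "\<tau> (x + y) mod p = (\<tau> x + \<tau> y) mod p"
      by (simp add: of_nat_eq_iff_cong_CHAR C cong_def del: of_nat_add)
    then show ?thesis unfolding \<psi>_def by (metis r_add r_mod)
  qed
  have norm: "cmod (\<psi> x) = 1" for x by (simp add: \<psi>_def r_def)
  have nontrivial: "\<exists>x. \<psi> x \<noteq> 1"
  proof -
    obtain x where "T x \<noteq> 0" using T(3) by blast
    then have "\<tau> x \<noteq> 0" using \<tau>(2)[of x] by (metis of_nat_0)
    then have "r (\<tau> x) \<noteq> 1"
      using bij_betw_imp_inj_on[OF bij] \<tau>(1)[of x] p1 r_0 by (metis inj_onD lessThan_iff less_trans zero_less_one)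
    then show ?thesis by (auto simp: \<psi>_def)
  qed
  have Ints: "(\<Sum>x\<in>A. \<psi> x) \<in> \<int>" if A: "\<And>j x. j \<in> {1..<p} \<Longrightarrow> x \<in> A \<Longrightarrow> of_nat j * x \<in> A" for A
  proof -
    define N where "N j = card {x \<in> A. \<tau> x = j}" for j
    have T_mult: "T (of_nat j * x) = of_nat j * T x" for j x
    proof (induction j)
      case 0
      have "T 0 = 0" using T(1)[of 0 0] by (metis add_0 add_cancel_right_right)
      then show ?case by simp
    qed (simp add: algebra_simps T)
    \<comment> \<open>Multiplication by \<open>j\<close> permutes \<open>A\<close> and carries the
      elements of trace 1 onto those of trace \<open>j\<close>.\<close>
    have N: "N j = N 1" if j: "j \<in> {1..<p}" for j
    proof -
      have j0: "(of_nat j :: 'a) \<noteq> 0"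
        using j by (auto simp: of_nat_eq_0_iff_char_dvd C dest: dvd_imp_le)
      have inj: "inj ((*) (of_nat j :: 'a))" using j0 by (simp add: inj_def)
      have "(*) (of_nat j) ` A \<subseteq> A" using A[OF j] by auto
      then have sA: "(*) (of_nat j) ` A = A"
        by (rule endo_inj_surj[OF finite]) (use inj inj_on_subset in blast)
      have \<tau>_iff: "\<tau> x = k \<longleftrightarrow> T x = of_nat k" if "k < p" for x k
      proof -
        have "\<tau> x = k \<longleftrightarrow> (of_nat (\<tau> x) :: 'a) = of_nat k"
          using \<tau>(1)[of x] that by (simp add: of_nat_eq_iff_cong_CHAR C cong_def)
        then show ?thesis by (simp add: \<tau>(2))
      qed
      have "{x \<in> A. \<tau> x = j} = (*) (of_nat j) ` {x \<in> A. \<tau> x = 1}"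
      proof (intro equalityI subsetI)
        fix x assume x: "x \<in> {x \<in> A. \<tau> x = j}"
        then obtain y where y: "y \<in> A" "x = of_nat j * y" using sA by blast
        then have "of_nat j * T y = of_nat j" using x j by (simp add: \<tau>_iff T_mult)
        then have "\<tau> y = 1" using j0 p1 by (simp add: \<tau>_iff)
        then show "x \<in> (*) (of_nat j) ` {x \<in> A. \<tau> x = 1}" using y by blast
      next
        fix x assume "x \<in> (*) (of_nat j) ` {x \<in> A. \<tau> x = 1}"
        then obtain y where y: "y \<in> A" "x = of_nat j * y" "T y = 1" using \<tau>_iff[OF p1] by auto
        then show "x \<in> {x \<in> A. \<tau> x = j}" using A[OF j] j by (simp add: \<tau>_iff T_mult)
      qed
      moreover have "inj_on ((*) (of_nat j :: 'a)) {x \<in> A. \<tau> x = 1}"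
        using inj inj_on_subset by blast
      ultimately show ?thesis by (simp add: N_def card_image)
    qed
    have "(\<Sum>x\<in>A. \<psi> x) = (\<Sum>j<p. \<Sum>x\<in>{x \<in> A. \<tau> x = j}. \<psi> x)"
      by (rule sum.group[symmetric]) (use \<tau>(1) in auto)
    also have "\<dots> = (\<Sum>j<p. of_nat (N j) * r j)"
      by (simp add: \<psi>_def N_def)
    \<comment> \<open>Every trace value but 0 occurs \<open>N 1\<close> times. As all the roots of
      unity add up to 0, only the correction \<open>N 0 - N 1\<close> at \<open>j = 0\<close>
      remains.\<close>
    also have "\<dots> = (\<Sum>j<p. of_nat (N 1) * r j + (if j = 0 then of_nat (N 0) - of_nat (N 1) else 0))"
    proof (rule sum.cong[OF refl])
      fix j assume "j \<in> {..<p}"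
      then show "of_nat (N j) * r j = of_nat (N 1) * r j + (if j = 0 then of_nat (N 0) - of_nat (N 1) else 0)"
        using N[of j] r_0 by (cases "j = 0") auto
    qed
    also have "\<dots> = of_nat (N 0) - of_nat (N 1)"
      using p1 r_sum by (simp add: sum.distrib flip: sum_distrib_left)
    finally show ?thesis by simp
  qed
  show ?thesis
    by (intro exI[of _ \<psi>] conjI allI impI add norm nontrivial Ints) simp_all
qed

section \<open>Fourier analysis on the additive group\<close>

locale additive_character =
  fixes \<psi> :: "'a::{field,finite} \<Rightarrow> complex"
  assumes add: "\<psi> (x + y) = \<psi> x * \<psi> y"
    and norm [simp]: "cmod (\<psi> x) = 1"
    and nontrivial: "\<exists>x. \<psi> x \<noteq> 1"
begin

lemma zero [simp]: "\<psi> 0 = 1"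
proof -
  have "\<psi> 0 * \<psi> 0 = \<psi> 0 * 1" using add[of 0 0] by simp
  moreover have "\<psi> 0 \<noteq> 0" using norm[of 0] by force
  ultimately show ?thesis by simp
qed

lemma minus: "\<psi> (- x) = cnj (\<psi> x)"
proof -
  have "\<psi> x * \<psi> (- x) = \<psi> x * cnj (\<psi> x)"
    using add[of x "- x"] complex_norm_square[of "\<psi> x"] by simp
  moreover have "\<psi> x \<noteq> 0" using norm[of x] by force
  ultimately show ?thesis by simp
qed

text \<open>For nonzero \<open>u\<close>, translating \<open>y\<close> by \<open>x / u\<close>
  multiplies the sum by \<open>\<psi> x\<close>, and \<open>x\<close> can be chosen with
  \<open>\<psi> x\<close> different from 1.\<close>

lemma orthogonality: "(\<Sum>y\<in>UNIV. \<psi> (y * u)) = (if u = 0 then of_nat CARD('a) else 0)"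
proof (cases "u = 0")
  case False
  obtain x where x: "\<psi> x \<noteq> 1" using nontrivial by blast
  have "(\<Sum>y\<in>UNIV. \<psi> (y * u)) = (\<Sum>y\<in>UNIV. \<psi> ((y + x / u) * u))"
    by (rule sum.reindex_bij_witness[of _ "\<lambda>y. y + x / u" "\<lambda>y. y - x / u"]) auto
  also have "\<dots> = (\<Sum>y\<in>UNIV. \<psi> (y * u)) * \<psi> x"
    using False by (simp add: distrib_right add sum_distrib_right)
  finally have "(\<Sum>y\<in>UNIV. \<psi> (y * u)) * (1 - \<psi> x) = 0" by (simp add: algebra_simps)
  then show ?thesis using x False by simp
qed simp

text \<open>Injectivity of the Fourier transform, by the inversion formula.\<close>

lemma fourier_zero:
  assumes "\<And>y. (\<Sum>v\<in>UNIV. f v * \<psi> (y * v)) = 0"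
  shows "f u = 0"
proof -
  have "0 = (\<Sum>y\<in>UNIV. (\<Sum>v\<in>UNIV. f v * \<psi> (y * v)) * \<psi> (y * (- u)))" by (simp add: assms)
  also have "\<dots> = (\<Sum>y\<in>UNIV. \<Sum>v\<in>UNIV. f v * \<psi> (y * (v - u)))"
    by (simp add: sum_distrib_right right_diff_distrib add[symmetric] mult.assoc)
  also have "\<dots> = (\<Sum>v\<in>UNIV. \<Sum>y\<in>UNIV. f v * \<psi> (y * (v - u)))" by (rule sum.swap)
  also have "\<dots> = (\<Sum>v\<in>UNIV. if v = u then f v * of_nat CARD('a) else 0)"
    by (simp add: orthogonality if_distrib cong: if_cong flip: sum_distrib_left)
  finally show ?thesis by simp
qed

end

section \<open>Cubic Gaussian periods and their moments\<close>

locale cubic_character_sums = additive_character \<psi>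
  for \<psi> :: "'a::{field,finite} \<Rightarrow> complex" +
  fixes n :: nat
  assumes n: "CARD('a) - 1 = 3 * n" and even_n: "even n"
begin

definition \<eta> :: "'a \<Rightarrow> complex"
  where "\<eta> y = (\<Sum>s\<in>power_residues 3. \<psi> (y * s))"

text \<open>Unlike the period, this sum runs over the whole field, so its powers count solutions of
  equations in cubes. It equals \<open>1 + 3 * \<eta> y\<close>.\<close>

definition \<theta> :: "'a \<Rightarrow> complex"
  where "\<theta> y = (\<Sum>x\<in>UNIV. \<psi> (y * x ^ 3))"

lemma card_eq: "CARD('a) = 3 * n + 1"
proof -
  have "CARD('a) > 0" by simp
  then show ?thesis using n by linarith
qed

lemma n_pos: "n > 0"
  using n card_mono[of "UNIV::'a set" "{0, 1}"] by (cases n) simp_all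

lemma \<theta>_eq: "\<theta> y = 1 + 3 * \<eta> y"
  unfolding \<theta>_def \<eta>_def using sum_cubes[OF n, of "\<lambda>s. \<psi> (y * s)"] by simp

lemma \<theta>_mult:
  assumes "s \<in> power_residues 3"
  shows "\<theta> (y * s) = \<theta> y"
proof -
  obtain c where c: "c \<noteq> 0" "s = c ^ 3" using assms by (auto simp: power_residues_def)
  have "\<theta> y = (\<Sum>x\<in>UNIV. \<psi> (y * (c * x) ^ 3))"
    unfolding \<theta>_def by (rule sum.reindex_bij_witness[of _ "\<lambda>x. c * x" "\<lambda>x. x / c"]) (use c in auto)
  then show ?thesis by (simp add: \<theta>_def c power_mult_distrib mult.assoc)
qed

lemma \<eta>_mult: "s \<in> power_residues 3 \<Longrightarrow> \<eta> (y * s) = \<eta> y"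
  using \<theta>_mult[of s y] by (simp add: \<theta>_eq)

lemma minus_one_cube: "- 1 \<in> power_residues 3"
  by (auto simp: power_residues_def intro!: exI[of _ "- 1"])

lemma \<eta>_minus: "\<eta> (- y) = \<eta> y"
  using \<eta>_mult[OF minus_one_cube, of y] by simp

text \<open>Conjugation replaces \<open>y\<close> by \<open>- y\<close>, and \<open>- 1\<close> is a
  cube.\<close>

lemma \<eta>_real: "\<eta> y \<in> \<real>"
proof -
  have "cnj (\<eta> y) = \<eta> (- y)" by (simp add: \<eta>_def minus)
  then show ?thesis by (simp add: \<eta>_minus Reals_cnj_iff)
qed

lemma \<eta>_zero: "\<eta> 0 = of_nat n"
  by (simp add: \<eta>_def card_power_residues_3[OF n])

lemma \<theta>_zero: "\<theta> 0 = of_nat CARD('a)"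
  by (simp add: \<theta>_def)

text \<open>Exchanging the sums and using orthogonality, the \<open>k\<close>-th moment is the field
  size times the number of zeros of a sum of \<open>k\<close> cubes, here for \<open>k = 1\<close>
  and below for 2 and 3.\<close>

lemma moment_1: "(\<Sum>y\<in>UNIV. \<theta> y) = of_nat CARD('a)"
proof -
  have "(\<Sum>y\<in>UNIV. \<theta> y) = (\<Sum>x\<in>UNIV. \<Sum>y\<in>UNIV. \<psi> (y * x ^ 3))"
    unfolding \<theta>_def by (rule sum.swap)
  then show ?thesis by (simp add: orthogonality)
qed

lemma moment_2: "(\<Sum>y\<in>UNIV. (\<theta> y)\<^sup>2) = of_nat CARD('a) * of_nat (card {(x::'a, y). x ^ 3 + y ^ 3 = 0})"
proof -
  have "(\<Sum>y\<in>UNIV. (\<theta> y)\<^sup>2) = (\<Sum>y\<in>UNIV. \<Sum>x\<in>UNIV. \<psi> (y * (fst x ^ 3 + snd x ^ 3)))"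
    unfolding power2_eq_square \<theta>_def sum_product sum.cartesian_product
    by (simp add: case_prod_beta distrib_left add)
  also have "\<dots> = (\<Sum>x\<in>UNIV. \<Sum>y\<in>UNIV. \<psi> (y * (fst x ^ 3 + snd x ^ 3)))" by (rule sum.swap)
  also have "\<dots> = of_nat CARD('a) * of_nat (card {x :: 'a \<times> 'a. fst x ^ 3 + snd x ^ 3 = 0})"
    by (simp add: orthogonality sum.If_cases)
  finally show ?thesis by (simp add: case_prod_beta')
qed

lemma moment_3:
  "(\<Sum>y\<in>UNIV. \<theta> y ^ 3) = of_nat CARD('a) * of_nat (card {(x::'a, y, z). x ^ 3 + y ^ 3 + z ^ 3 = 0})"
proof -
  have "(\<Sum>y\<in>UNIV. \<theta> y ^ 3) =
      (\<Sum>y\<in>UNIV. \<Sum>x\<in>UNIV. \<psi> (y * (fst (fst x) ^ 3 + snd (fst x) ^ 3 + snd x ^ 3)))"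
    unfolding power3_eq_cube \<theta>_def sum_product sum.cartesian_product
    by (simp add: case_prod_beta distrib_left add)
  also have "\<dots> = (\<Sum>x\<in>UNIV. \<Sum>y\<in>UNIV. \<psi> (y * (fst (fst x) ^ 3 + snd (fst x) ^ 3 + snd x ^ 3)))"
    by (rule sum.swap)
  also have "\<dots> = of_nat CARD('a) *
      of_nat (card {x :: ('a \<times> 'a) \<times> 'a. fst (fst x) ^ 3 + snd (fst x) ^ 3 + snd x ^ 3 = 0})"
    by (simp add: orthogonality sum.If_cases)
  also have "card {x :: ('a \<times> 'a) \<times> 'a. fst (fst x) ^ 3 + snd (fst x) ^ 3 + snd x ^ 3 = 0} =
      card {(x::'a, y, z). x ^ 3 + y ^ 3 + z ^ 3 = 0}"
    by (rule bij_betw_same_card[of "\<lambda>((x, y), z). (x, y, z)"])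
      (auto simp: bij_betw_def inj_on_def image_iff)
  finally show ?thesis .
qed

text \<open>As \<open>- 1\<close> is a cube, each of the \<open>3 * n\<close> nonzero
  \<open>x\<close> has three partners, and 0 has one.\<close>

lemma card_pair_cube_zeros: "card {(x::'a, y). x ^ 3 + y ^ 3 = 0} = 9 * n + 1"
proof -
  have "{(x::'a, y). x ^ 3 + y ^ 3 = 0} = (SIGMA x:UNIV. {y. y ^ 3 = (- x) ^ 3})"
    by (auto simp: add_eq_0_iff)
  then have "card {(x::'a, y). x ^ 3 + y ^ 3 = 0} = (\<Sum>x\<in>(UNIV::'a set). card {y. y ^ 3 = (- x) ^ 3})"
    by simp
  also have "\<dots> = (\<Sum>x\<in>(UNIV::'a set). if x = 0 then 1 else 3)"
  proof (rule sum.cong[OF refl])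
    fix x :: 'a
    show "card {y. y ^ 3 = (- x) ^ 3} = (if x = 0 then 1 else 3)"
      using card_cube_fibre[OF n, of "- x"] by (cases "x = 0") simp_all
  qed
  also have "\<dots> = 9 * n + 1"
    by (simp add: sum.remove[of UNIV 0] card_eq)
  finally show ?thesis .
qed

text \<open>Splitting each moment over the cosets leaves \<open>q ^ k\<close> from
  \<open>y = 0\<close> and \<open>n\<close> times a power sum of three values. Since these add up to
  0, their cubes add up to three times their product, and \<open>3 * n = q - 1\<close>.\<close>

lemma moments:
  assumes g: "g \<noteq> 0" "g ^ n \<noteq> 1"
  defines "q \<equiv> of_nat CARD('a)"
  shows "\<theta> 1 + \<theta> g + \<theta> (g\<^sup>2) = 0"
    and "(\<theta> 1)\<^sup>2 + (\<theta> g)\<^sup>2 + (\<theta> (g\<^sup>2))\<^sup>2 = 6 * q"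
    and "(q - 1) * (\<theta> 1 * \<theta> g * \<theta> (g\<^sup>2)) =
      q * (of_nat (card {(x::'a, y, z). x ^ 3 + y ^ 3 + z ^ 3 = 0}) - q\<^sup>2)"
proof -
  have q: "q = 3 * of_nat n + 1" unfolding q_def card_eq by simp
  have n0: "of_nat n \<noteq> (0::complex)" using n_pos by simp
  have s: "(\<Sum>y\<in>UNIV. \<theta> y ^ k) = q ^ k + of_nat n * (\<theta> 1 ^ k + \<theta> g ^ k + \<theta> (g\<^sup>2) ^ k)" for k
    by (subst sum_cube_cosets[OF n g]) (simp_all add: \<theta>_mult \<theta>_zero q_def)
  show 1: "\<theta> 1 + \<theta> g + \<theta> (g\<^sup>2) = 0"
    using s[of 1] moment_1 n0 by (simp add: q_def)
  have "of_nat n * ((\<theta> 1)\<^sup>2 + (\<theta> g)\<^sup>2 + (\<theta> (g\<^sup>2))\<^sup>2) = of_nat n * (6 * q)"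
    using s[of 2] moment_2 unfolding card_pair_cube_zeros q_def[symmetric]
    by (simp add: q algebra_simps power2_eq_square)
  then show "(\<theta> 1)\<^sup>2 + (\<theta> g)\<^sup>2 + (\<theta> (g\<^sup>2))\<^sup>2 = 6 * q" using n0 by simp
  have \<theta>2: "\<theta> (g\<^sup>2) = - \<theta> 1 - \<theta> g" using 1 by (simp add: algebra_simps add_eq_0_iff)
  have "\<theta> 1 ^ 3 + \<theta> g ^ 3 + \<theta> (g\<^sup>2) ^ 3 = 3 * (\<theta> 1 * \<theta> g * \<theta> (g\<^sup>2))"
    unfolding \<theta>2 by (simp add: algebra_simps power3_eq_cube)
  then show "(q - 1) * (\<theta> 1 * \<theta> g * \<theta> (g\<^sup>2)) =
      q * (of_nat (card {(x::'a, y, z). x ^ 3 + y ^ 3 + z ^ 3 = 0}) - q\<^sup>2)"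
    using s[of 3] moment_3 unfolding q_def[symmetric]
    by (simp add: q algebra_simps power2_eq_square power3_eq_cube)
qed

end

section \<open>Spectrum and connectedness\<close>

text \<open>The columns of \<open>W\<close> are eigenvectors, so
  \<open>(mat x - M) ** W = W ** D\<close> with \<open>D\<close> diagonal. Taking determinants,
  \<open>det W\<close> cancels.\<close>

lemma proots_charpoly_eigenbasis:
  fixes M W :: "complex^'n^'n"
  assumes eig: "\<And>i j. (M ** W) $ i $ j = d j * W $ i $ j" and W: "det W \<noteq> 0"
  shows "proots (charpoly M) = image_mset d (mset_set UNIV)"
proof -
  have "poly (charpoly M) x = poly (\<Prod>i\<in>UNIV. [:- d i, 1:]) x" for x
  proof -
    define D :: "complex^'n^'n" where "D = (\<chi> i j. if i = j then x - d j else 0)"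
    have "((mat x - M) ** W) $ i $ j = (W ** D) $ i $ j" for i j
    proof -
      have "((mat x - M) ** W) $ i $ j = (\<Sum>k\<in>UNIV. (if i = k then x else 0) * W $ k $ j) - (M ** W) $ i $ j"
        by (simp add: matrix_matrix_mult_def mat_def left_diff_distrib sum_subtractf)
      also have "(\<Sum>k\<in>UNIV. (if i = k then x else 0) * W $ k $ j) = x * W $ i $ j"
        by (simp add: if_distrib if_distribR cong: if_cong)
      finally have "((mat x - M) ** W) $ i $ j = (x - d j) * W $ i $ j"
        by (simp add: eig left_diff_distrib)
      moreover have "(W ** D) $ i $ j = (x - d j) * W $ i $ j"
        by (simp add: matrix_matrix_mult_def D_def if_distrib if_distribR cong: if_cong)
      ultimately show ?thesis by simp
    qed
    then have "(mat x - M) ** W = W ** D" by (simp add: vec_eq_iff)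
    then have "det (mat x - M) * det W = det W * det D" by (metis det_mul)
    moreover have "det D = (\<Prod>i\<in>UNIV. x - d i)" by (subst det_diagonal) (simp_all add: D_def)
    ultimately show ?thesis using W by (simp add: poly_charpoly poly_prod)
  qed
  then have "charpoly M = (\<Prod>i\<in>UNIV. [:- d i, 1:])" by (simp add: poly_eq_poly_eq_iff[symmetric] fun_eq_iff)
  moreover have "(\<Sum>i\<in>A. {#d i#}) = image_mset d (mset_set A)" if "finite A" for A :: "'n set"
    using that by induction auto
  ultimately show ?thesis by (simp add: proots_prod)
qed

section \<open>A real eigenbasis of the adjacency matrix\<close>

context cubic_character_sums
begin

text \<open>The field size \<open>3 * n + 1\<close> is odd and vanishes in the field, so 2 does not
  vanish there.\<close>

lemma minus_neq: "(y::'a) \<noteq> 0 \<Longrightarrow> - y \<noteq> y"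
proof
  assume y: "y \<noteq> 0" "- y = y"
  then have "2 * y = 0" by (metis add.right_inverse mult_2)
  then have two: "(2::'a) = 0" using y by simp
  have "(\<Sum>x\<in>(UNIV::'a set). x ^ 0) = 0" by (subst finite_field_power_sum) simp
  then have "of_nat (3 * n + 1) = (0::'a)" by (simp only: power_0 sum_constant mult_1_right card_eq)
  moreover obtain k where "n = 2 * k" using even_n by auto
  then have "of_nat (3 * n + 1) = 2 * (3 * of_nat k) + (1::'a)" by simp
  ultimately show False using two by simp
qed

text \<open>One of each pair \<open>y\<close>, \<open>- y\<close> is chosen by comparing codes.
  Opposite elements give conjugate characters, so the chosen one can carry the imaginary part and
  the other the real part.\<close>

lemma ex_half_system: "\<exists>N::'a set. 0 \<notin> N \<and> (\<forall>y. y \<noteq> 0 \<longrightarrow> (- y \<in> N \<longleftrightarrow> y \<notin> N))"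
proof (intro exI[of _ "{y. to_nat y < to_nat (- y)}"] conjI allI impI)
  fix y :: 'a assume "y \<noteq> 0"
  then have "to_nat y \<noteq> to_nat (- y)" using minus_neq[of y] by (metis to_nat_split)
  then show "- y \<in> {y. to_nat y < to_nat (- y)} \<longleftrightarrow> y \<notin> {y. to_nat y < to_nat (- y)}"
    unfolding mem_Collect_eq minus_minus by linarith
qed simp

text \<open>The adjacency operator maps \<open>v \<mapsto> \<psi> (y * v)\<close> to \<open>\<eta> y\<close> times its conjugate, so the real
  part is an eigenvector for \<open>\<eta> y\<close> and the imaginary part for \<open>- \<eta> y\<close>.\<close>

definition basis :: "'a set \<Rightarrow> 'a \<Rightarrow> 'a \<Rightarrow> complex"
  where "basis N y v = of_real (if y \<in> N then Im (\<psi> (y * v)) else Re (\<psi> (y * v)))"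

definition eigenvalue :: "'a set \<Rightarrow> 'a \<Rightarrow> complex"
  where "eigenvalue N y = (if y \<in> N then - \<eta> y else \<eta> y)"

text \<open>The neighbours of \<open>v\<close> are the \<open>s - v\<close> with \<open>s\<close> a
  nonzero cube. As \<open>\<eta> y\<close> is real, real and imaginary parts can be compared
  separately.\<close>

lemma basis_eigenvector:
  "(\<Sum>s\<in>power_residues 3. basis N y (s - v)) = eigenvalue N y * basis N y v"
proof -
  obtain h where h: "\<eta> y = of_real h" using \<eta>_real by (auto elim: Reals_cases)
  have "(\<Sum>s\<in>power_residues 3. \<psi> (y * (s - v))) = \<eta> y * cnj (\<psi> (y * v))"
    by (simp add: \<eta>_def sum_distrib_right right_diff_distrib flip: minus add)
  then have *: "(\<Sum>s\<in>power_residues 3. \<psi> (y * (s - v))) = of_real h * cnj (\<psi> (y * v))"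
    by (simp add: h)
  have "(\<Sum>s\<in>power_residues 3. Re (\<psi> (y * (s - v)))) = h * Re (\<psi> (y * v))"
    "(\<Sum>s\<in>power_residues 3. Im (\<psi> (y * (s - v)))) = - h * Im (\<psi> (y * v))"
    using arg_cong[OF *, of Re] arg_cong[OF *, of Im] by simp_all
  then show ?thesis
    by (auto simp: basis_def eigenvalue_def h simp flip: of_real_sum of_real_mult of_real_minus)
qed

text \<open>Of \<open>y\<close> and \<open>- y\<close>, one supplies the real and the other the
  imaginary part of the character, so all Fourier coefficients of \<open>f\<close> vanish.\<close>

lemma basis_complete:
  assumes N: "0 \<notin> N" "\<And>y. y \<noteq> 0 \<Longrightarrow> - y \<in> N \<longleftrightarrow> y \<notin> N" and f: "\<And>y. (\<Sum>v\<in>UNIV. f v * basis N y v) = 0"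
  shows "f u = 0"
proof (rule fourier_zero)
  fix y
  have re: "(\<Sum>v\<in>UNIV. f v * of_real (Re (\<psi> (y * v)))) = 0"
  proof (cases "y \<in> N")
    case True
    then have "- y \<notin> N" using N by metis
    then show ?thesis using f[of "- y"] by (simp add: basis_def minus)
  next
    case False
    then show ?thesis using f[of y] by (simp add: basis_def)
  qed
  \<comment> \<open>For \<open>y = 0\<close> there is no partner in \<open>N\<close>, but the
    imaginary part of \<open>\<psi> 0 = 1\<close> is 0.\<close>
  have im: "(\<Sum>v\<in>UNIV. f v * of_real (Im (\<psi> (y * v)))) = 0"
  proof (cases "y \<in> N \<or> y = 0")
    case True
    then show ?thesis using f[of y] by (auto simp: basis_def)
  next
    case False
    then have "- y \<in> N" using N by blast
    then show ?thesis using f[of "- y"] by (simp add: basis_def minus sum_negf)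
  qed
  have "(\<Sum>v\<in>UNIV. f v * \<psi> (y * v)) =
      (\<Sum>v\<in>UNIV. f v * of_real (Re (\<psi> (y * v))) + \<i> * (f v * of_real (Im (\<psi> (y * v)))))"
    by (intro sum.cong refl, subst complex_eq) (simp add: algebra_simps)
  then show "(\<Sum>v\<in>UNIV. f v * \<psi> (y * v)) = 0"
    using re im by (simp add: sum.distrib flip: sum_distrib_left)
qed

text \<open>The basis vectors form the columns of \<open>W\<close>; completeness says that its
  transpose has trivial kernel.\<close>

lemma graph_eigenvalues_eq_image:
  assumes N: "0 \<notin> N" "\<And>y. y \<noteq> 0 \<Longrightarrow> - y \<in> N \<longleftrightarrow> y \<notin> N"
  shows "graph_eigenvalues (gen_paley_sum_graph 3 :: 'a pair_pre_digraph) =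
    image_mset (eigenvalue N) (mset_set UNIV)"
proof -
  define A where "A = adjacency_matrix (gen_paley_sum_graph 3 :: 'a pair_pre_digraph)"
  define W :: "((complex, 'a) vec, 'a) vec" where "W = (\<chi> v y. basis N y v)"
  have "(A ** W) $ v $ y = eigenvalue N y * W $ v $ y" for v y
  proof -
    have "(A ** W) $ v $ y = (\<Sum>w\<in>UNIV. if v + w \<in> power_residues 3 then basis N y w else 0)"
      unfolding A_def W_def matrix_matrix_mult_def adjacency_matrix_def gen_paley_sum_graph_def
      by (auto intro: sum.cong)
    also have "\<dots> = (\<Sum>w\<in>{w. v + w \<in> power_residues 3}. basis N y w)"
      by (simp add: sum.If_cases)
    also have "\<dots> = (\<Sum>s\<in>power_residues 3. basis N y (s - v))"
      by (rule sum.reindex_bij_witness[of _ "\<lambda>s. s - v" "\<lambda>w. v + w"]) auto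
    finally show ?thesis by (simp add: basis_eigenvector W_def)
  qed
  moreover have "det W \<noteq> 0"
  proof -
    have "\<exists>B. B ** transpose W = mat 1"
      unfolding matrix_left_invertible_ker
    proof (intro allI impI)
      fix f :: "(complex, 'a) vec" assume f: "transpose W *v f = 0"
      have "(\<Sum>v\<in>UNIV. f $ v * basis N y v) = 0" for y
        using arg_cong[OF f, of "\<lambda>x. x $ y"]
        by (simp add: matrix_vector_mult_def transpose_def W_def mult.commute)
      then show "f = 0" using basis_complete[OF N] by (simp add: vec_eq_iff)
    qed
    then show ?thesis by (metis invertible_det_nz invertible_left_inverse det_transpose)
  qed
  ultimately show ?thesis
    unfolding graph_eigenvalues_def A_def by (rule proots_charpoly_eigenbasis)
qed

text \<open>As \<open>- 1\<close> is a cube, negation preserves the coset and swaps its part in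
  \<open>N\<close> with the rest, so each part has \<open>n div 2\<close> elements.\<close>

lemma image_mset_eigenvalue_coset:
  assumes N: "\<And>y. y \<noteq> 0 \<Longrightarrow> - y \<in> N \<longleftrightarrow> y \<notin> N" and c: "c \<noteq> 0"
  shows "image_mset (eigenvalue N) (mset_set ((*) c ` power_residues 3)) =
    replicate_mset (n div 2) (\<eta> c) + replicate_mset (n div 2) (- \<eta> c)"
proof -
  define X where "X = (*) c ` power_residues 3"
  have X0: "0 \<notin> X" using c by (auto simp: X_def power_residues_def)
  have mX: "- y \<in> X" if y: "y \<in> X" for y
  proof -
    obtain x where x: "x \<noteq> 0" "y = c * x ^ 3" using y by (auto simp: X_def power_residues_def)
    then have "- y = c * (- x) ^ 3" "- x \<noteq> 0" by simp_all
    then show ?thesis unfolding X_def power_residues_def by blast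
  qed
  have cX: "card X = n"
    using c card_power_residues_3[OF n] by (simp add: X_def card_image inj_on_def)
  have "bij_betw uminus (X \<inter> N) (X - N)"
  proof (rule bij_betw_byWitness[of _ uminus])
    have "- y \<in> N \<longleftrightarrow> y \<notin> N" if "y \<in> X" for y
      using N[of y] X0 that by metis
    then show "uminus ` (X \<inter> N) \<subseteq> X - N" "uminus ` (X - N) \<subseteq> X \<inter> N"
      using mX by auto
  qed simp_all
  then have e: "card (X \<inter> N) = card (X - N)" by (rule bij_betw_same_card)
  moreover have "X = (X \<inter> N) \<union> (X - N)" by blast
  then have "card X = card (X \<inter> N) + card (X - N)"
    by (metis card_Un_disjoint Diff_disjoint Int_assoc finite inf_bot_right)
  ultimately have h: "card (X \<inter> N) = n div 2" "card (X - N) = n div 2" using cX by simp_all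
  have \<eta>X: "\<eta> y = \<eta> c" if "y \<in> X" for y using that by (auto simp: X_def \<eta>_mult)
  have "mset_set X = mset_set (X - N) + mset_set (X \<inter> N)"
    using mset_set_Union[of "X - N" "X \<inter> N"] by (simp add: Un_Diff_Int Diff_Int_distrib2)
  moreover have "image_mset (eigenvalue N) (mset_set (X - N)) = image_mset (\<lambda>_. \<eta> c) (mset_set (X - N))"
    by (rule image_mset_cong) (auto simp: eigenvalue_def \<eta>X)
  moreover have "image_mset (eigenvalue N) (mset_set (X \<inter> N)) = image_mset (\<lambda>_. - \<eta> c) (mset_set (X \<inter> N))"
    by (rule image_mset_cong) (auto simp: eigenvalue_def \<eta>X)
  ultimately show ?thesis by (simp add: X_def[symmetric] image_mset_const_eq h)
qed

lemma graph_eigenvalues_eq: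
  assumes g: "g \<noteq> 0" "g ^ n \<noteq> 1"
  shows "graph_eigenvalues (gen_paley_sum_graph 3 :: 'a pair_pre_digraph) =
    {#of_nat n#} +
    (replicate_mset (n div 2) (\<eta> 1) + replicate_mset (n div 2) (- \<eta> 1)) +
    (replicate_mset (n div 2) (\<eta> g) + replicate_mset (n div 2) (- \<eta> g)) +
    (replicate_mset (n div 2) (\<eta> (g\<^sup>2)) + replicate_mset (n div 2) (- \<eta> (g\<^sup>2)))"
proof -
  obtain N :: "'a set" where N: "0 \<notin> N" "\<And>y. y \<noteq> 0 \<Longrightarrow> - y \<in> N \<longleftrightarrow> y \<notin> N"
    using ex_half_system by blast
  define S :: "'a set" where "S = power_residues 3"
  note cos = power_residues_3_cosets[OF n g, folded S_def]
  have "mset_set (UNIV :: 'a set) = {#0#} + mset_set (UNIV - {0})"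
    using mset_set.insert[of "UNIV - {0::'a}" 0] by (simp add: insert_absorb)
  also have "mset_set (UNIV - {0::'a}) = mset_set ((*) 1 ` S) + mset_set ((*) g ` S) + mset_set ((*) (g\<^sup>2) ` S)"
    unfolding cos(1) using cos(2,3) by (simp add: mset_set_Union)
  finally have "image_mset (eigenvalue N) (mset_set UNIV) = {#eigenvalue N 0#} +
      image_mset (eigenvalue N) (mset_set ((*) 1 ` S)) + image_mset (eigenvalue N) (mset_set ((*) g ` S)) +
      image_mset (eigenvalue N) (mset_set ((*) (g\<^sup>2) ` S))"
    by (simp add: add.assoc)
  also have "image_mset (eigenvalue N) (mset_set ((*) 1 ` S)) =
      replicate_mset (n div 2) (\<eta> 1) + replicate_mset (n div 2) (- \<eta> 1)"
    unfolding S_def by (rule image_mset_eigenvalue_coset[OF N(2)]) simp_all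
  also have "image_mset (eigenvalue N) (mset_set ((*) g ` S)) =
      replicate_mset (n div 2) (\<eta> g) + replicate_mset (n div 2) (- \<eta> g)"
    unfolding S_def by (rule image_mset_eigenvalue_coset[OF N(2) g(1)])
  also have "image_mset (eigenvalue N) (mset_set ((*) (g\<^sup>2) ` S)) =
      replicate_mset (n div 2) (\<eta> (g\<^sup>2)) + replicate_mset (n div 2) (- \<eta> (g\<^sup>2))"
    unfolding S_def by (rule image_mset_eigenvalue_coset[OF N(2)]) (simp_all add: g)
  also have "eigenvalue N 0 = of_nat n"
    using N(1) by (simp add: eigenvalue_def \<eta>_zero)
  finally have E: "image_mset (eigenvalue N) (mset_set UNIV) = {#of_nat n#} +
    (replicate_mset (n div 2) (\<eta> 1) + replicate_mset (n div 2) (- \<eta> 1)) +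
    (replicate_mset (n div 2) (\<eta> g) + replicate_mset (n div 2) (- \<eta> g)) +
    (replicate_mset (n div 2) (\<eta> (g\<^sup>2)) + replicate_mset (n div 2) (- \<eta> (g\<^sup>2)))" .
  show ?thesis by (subst graph_eigenvalues_eq_image[OF N]) (assumption | rule E)+
qed

text \<open>The indicator function \<open>f\<close> of \<open>K\<close> is invariant under
  \<open>v \<mapsto> s - v\<close> for each nonzero cube \<open>s\<close>. Summing over
  \<open>s\<close> shows that \<open>f\<close> is orthogonal to every basis vector whose eigenvalue
  is not \<open>n\<close>, hence to all but the constant one; so \<open>f\<close> is
  constant.\<close>

lemma closed_set_eq_UNIV:
  fixes K :: "'a set"
  assumes \<eta>: "\<And>y. y \<noteq> 0 \<Longrightarrow> \<eta> y \<noteq> of_nat n \<and> \<eta> y \<noteq> - of_nat n"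
    and K: "\<And>v w. v \<in> K \<Longrightarrow> v + w \<in> power_residues 3 \<Longrightarrow> w \<in> K" "K \<noteq> {}"
  shows "K = UNIV"
proof -
  obtain N :: "'a set" where N: "0 \<notin> N" "\<And>y. y \<noteq> 0 \<Longrightarrow> - y \<in> N \<longleftrightarrow> y \<notin> N"
    using ex_half_system by blast
  define f :: "'a \<Rightarrow> complex" where "f v = (if v \<in> K then 1 else 0)" for v
  define F where "F y = (\<Sum>v\<in>UNIV. f v * basis N y v)" for y
  have f: "f (s - v) = f v" if "s \<in> power_residues 3" for s v
    using K(1)[of v "s - v"] K(1)[of "s - v" v] that by (auto simp: f_def)
  have F: "F y = 0" if "y \<noteq> 0" for y
  proof -
    have "of_nat n * F y = (\<Sum>s\<in>(power_residues 3 :: 'a set). \<Sum>v\<in>UNIV. f v * basis N y v)"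
      using card_power_residues_3[OF n] by (simp add: F_def)
    also have "\<dots> = (\<Sum>s\<in>power_residues 3. \<Sum>v\<in>UNIV. f v * basis N y (s - v))"
    proof (rule sum.cong[OF refl])
      fix s :: 'a assume s: "s \<in> power_residues 3"
      show "(\<Sum>v\<in>UNIV. f v * basis N y v) = (\<Sum>v\<in>UNIV. f v * basis N y (s - v))"
        by (rule sum.reindex_bij_witness[of _ "\<lambda>v. s - v" "\<lambda>v. s - v"]) (auto simp: f s)
    qed
    also have "\<dots> = (\<Sum>v\<in>UNIV. \<Sum>s\<in>power_residues 3. f v * basis N y (s - v))" by (rule sum.swap)
    also have "\<dots> = (\<Sum>v\<in>UNIV. f v * (eigenvalue N y * basis N y v))"
      by (simp add: basis_eigenvector flip: sum_distrib_left)
    also have "\<dots> = eigenvalue N y * F y"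
      by (simp add: F_def sum_distrib_left mult.left_commute)
    finally have "(of_nat n - eigenvalue N y) * F y = 0" by (simp add: left_diff_distrib)
    moreover have "eigenvalue N y \<noteq> of_nat n"
      using \<eta>[OF that] by (auto simp: eigenvalue_def minus_equation_iff)
    ultimately show ?thesis by simp
  qed
  \<comment> \<open>\<open>c\<close> is the mean of \<open>f\<close>, so \<open>f - c\<close> is
    orthogonal to the constant vector at \<open>y = 0\<close> as well.\<close>
  define c where "c = F 0 / of_nat CARD('a)"
  have "(\<Sum>v\<in>UNIV. (f v - c) * basis N y v) = 0" for y
  proof (cases "y = 0")
    case True
    then have "basis N y v = 1" for v using N(1) by (simp add: basis_def)
    then show ?thesis using True by (simp add: sum_subtractf c_def F_def)
  next
    case False
    then have "(\<Sum>v\<in>UNIV. \<psi> (v * y)) = 0" by (simp add: orthogonality)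
    then have "(\<Sum>v\<in>UNIV. Re (\<psi> (y * v))) = 0" "(\<Sum>v\<in>UNIV. Im (\<psi> (y * v))) = 0"
      by (simp_all add: mult.commute complex_eq_iff)
    then have "(\<Sum>v\<in>UNIV. basis N y v) = 0"
      by (cases "y \<in> N") (simp_all add: basis_def flip: of_real_sum)
    then show ?thesis
      using F[OF False] by (simp add: left_diff_distrib sum_subtractf F_def flip: sum_distrib_left)
  qed
  then have "f v - c = 0" for v using basis_complete[OF N, of "\<lambda>v. f v - c"] by blast
  then have "f v = f w" for v w by (metis eq_iff_diff_eq_0)
  moreover obtain u where "u \<in> K" using K(2) by blast
  ultimately have "f v = 1" for v by (metis f_def)
  then have "v \<in> K" for v by (metis f_def zero_neq_one)
  then show ?thesis by blast
qed

text \<open>The vertices reachable from a fixed \<open>u\<close> form a closed set.\<close>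

lemma connected_gen_paley_sum_graph:
  assumes \<eta>: "\<And>y. y \<noteq> 0 \<Longrightarrow> \<eta> y \<noteq> of_nat n \<and> \<eta> y \<noteq> - of_nat n"
  shows "Digraph_Component.connected (with_proj (gen_paley_sum_graph 3 :: 'a pair_pre_digraph))"
proof -
  define H where "H = with_proj (mk_symmetric (with_proj (gen_paley_sum_graph 3 :: 'a pair_pre_digraph)))"
  have "(u, v) \<in> rtrancl_on (verts H) (arcs_ends H)" for u v
  proof -
    have V: "verts H = UNIV" by (simp add: H_def gen_paley_sum_graph_def)
    have "{v. (u, v) \<in> rtrancl_on (verts H) (arcs_ends H)} = UNIV"
    proof (rule closed_set_eq_UNIV[OF \<eta>])
      fix v w assume "v \<in> {v. (u, v) \<in> rtrancl_on (verts H) (arcs_ends H)}" "v + w \<in> power_residues 3"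
      moreover from this(2) have "(v, w) \<in> arcs_ends H"
        by (force simp: H_def gen_paley_sum_graph_def parcs_mk_symmetric)
      ultimately show "w \<in> {v. (u, v) \<in> rtrancl_on (verts H) (arcs_ends H)}"
        using V by (auto intro: rtrancl_on_into_rtrancl_on)
    qed (use V in auto)
    then show ?thesis by blast
  qed
  then show ?thesis
    unfolding Digraph_Component.connected_def Digraph_Component.strongly_connected_def H_def reachable_def
    by (simp add: gen_paley_sum_graph_def)
qed

end

text \<open>What both residue classes of \<open>p\<close> share, in terms of integers:
  \<open>x\<close>, \<open>y\<close>, \<open>z\<close> are the values of \<open>\<theta>\<close> at
  \<open>1\<close>, \<open>g\<close>, \<open>g ^ 2\<close>, and \<open>M\<close> counts the zeros of
  the Fermat cubic.\<close>

lemma ex_integer_periods: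
  fixes G :: "'a::{field,finite} pair_pre_digraph"
  assumes p: "prime p" "odd p" and q: "CARD('a) = p ^ m" and dvd: "3 dvd (p ^ m - 1) div (p - 1)"
    and n_eq: "n = (p ^ m - 1) div 3" and G: "G = gen_paley_sum_graph 3"
  shows "\<exists>x y z M :: int. [x = 1] (mod 3) \<and> [y = 1] (mod 3) \<and> [z = 1] (mod 3) \<and>
    x + y + z = 0 \<and> x\<^sup>2 + y\<^sup>2 + z\<^sup>2 = 6 * int p ^ m \<and>
    (int p ^ m - 1) * (x * y * z) = int p ^ m * (M - (int p ^ m)\<^sup>2) \<and>
    ([p = 1] (mod 3) \<longrightarrow> \<not> int p dvd M) \<and>
    Digraph_Component.connected (with_proj G) \<and>
    graph_eigenvalues G = {#of_nat n#} + pm_mult ((of_int x - 1) / 3) (n div 2) +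
      pm_mult ((of_int y - 1) / 3) (n div 2) + pm_mult ((of_int z - 1) / 3) (n div 2)"
proof -
  have p3: "p \<ge> 3" using p prime_ge_2_nat[of p] by (cases "p = 2") auto
  \<comment> \<open>\<open>p - 1\<close> divides \<open>p ^ m - 1\<close> with a quotient divisible
    by 3, so \<open>n\<close> is a multiple of the even number \<open>p - 1\<close>.\<close>
  have "[p = 1] (mod (p - 1))" using p3 by (simp add: cong_altdef_nat)
  then have "[p ^ m = 1 ^ m] (mod (p - 1))" by (rule cong_pow)
  then have "p - 1 dvd p ^ m - 1" by (intro cong_to_1_nat) simp
  then have "p ^ m - 1 = (p - 1) * ((p ^ m - 1) div (p - 1))" by simp
  moreover obtain j where "(p ^ m - 1) div (p - 1) = 3 * j" using dvd by auto
  ultimately have q1: "p ^ m - 1 = 3 * ((p - 1) * j)" by simp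
  then have nj: "n = (p - 1) * j" using n_eq by simp
  have n3: "CARD('a) - 1 = 3 * n" using q1 by (simp add: q nj)
  have en: "even n" using p(2) p3 by (simp add: nj)
  obtain \<psi> :: "'a \<Rightarrow> complex" where \<psi>: "\<And>x y. \<psi> (x + y) = \<psi> x * \<psi> y" "\<And>x. cmod (\<psi> x) = 1"
      "\<exists>x. \<psi> x \<noteq> 1"
    and Ints: "\<And>A. (\<And>j x. j \<in> {1..<p} \<Longrightarrow> x \<in> A \<Longrightarrow> of_nat j * x \<in> A) \<Longrightarrow> (\<Sum>x\<in>A. \<psi> x) \<in> \<int>"
    using ex_additive_character[OF p(1) q] by metis
  interpret cubic_character_sums \<psi> n
    using \<psi> n3 en by unfold_locales auto
  \<comment> \<open>A unit \<open>c\<close> of the prime field has \<open>c ^ (p - 1) = 1\<close>,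
    hence \<open>c ^ n = 1\<close>.\<close>
  have prime_units: "of_nat i \<in> (power_residues 3 :: 'a set)" if i: "i \<in> {1..<p}" for i
  proof -
    note C = CHAR_eq_prime[OF p(1) q]
    define c :: 'a where "c = of_nat i"
    have "c \<noteq> 0" using i by (auto simp: c_def of_nat_eq_0_iff_char_dvd C dest: dvd_imp_le)
    moreover have "c ^ p = c" using prime_subfield_eq[OF p(1) C] i by (auto simp: c_def)
    then have "c * c ^ (p - 1) = c * 1" using p3 by (simp flip: power_Suc)
    ultimately have "c ^ (p - 1) = 1" by simp
    then show ?thesis by (simp add: power_residues_3_eq[OF n3] nj power_mult flip: c_def)
  qed
  have \<eta>_Ints: "\<eta> y \<in> \<int>" if y: "y \<noteq> 0" for y
  proof -
    have "\<eta> y = (\<Sum>x\<in>(*) y ` power_residues 3. \<psi> x)"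
      unfolding \<eta>_def using y by (subst sum.reindex) (auto simp: inj_on_def)
    also have "\<dots> \<in> \<int>"
    proof (rule Ints)
      fix i x assume i: "i \<in> {1..<p}" and "x \<in> (*) y ` power_residues 3"
      then obtain s where s: "s \<in> power_residues 3" "x = y * s" by blast
      have "of_nat i * s \<in> power_residues 3"
        using prime_units[OF i] s(1) by (simp add: power_residues_3_eq[OF n3] power_mult_distrib)
      moreover have "of_nat i * x = y * (of_nat i * s)" using s by (simp add: mult_ac)
      ultimately show "of_nat i * x \<in> (*) y ` power_residues 3" by blast
    qed
    finally show ?thesis .
  qed
  obtain g :: 'a where g: "g \<noteq> 0" "g ^ n \<noteq> 1" using nontrivial_cube_root[OF n3] by metis
  obtain h0 h1 h2 where h: "\<eta> 1 = of_int h0" "\<eta> g = of_int h1" "\<eta> (g\<^sup>2) = of_int h2"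
    using \<eta>_Ints[of 1] \<eta>_Ints[of g] \<eta>_Ints[of "g\<^sup>2"] g by (auto elim!: Ints_cases)
  define x y z where xyz: "x = 1 + 3 * h0" "y = 1 + 3 * h1" "z = 1 + 3 * h2"
  have \<theta>: "\<theta> 1 = of_int x" "\<theta> g = of_int y" "\<theta> (g\<^sup>2) = of_int z"
    by (simp_all add: \<theta>_eq h xyz)
  define M where "M = card {(x::'a, y, z). x ^ 3 + y ^ 3 + z ^ 3 = 0}"
  define Q where "Q = int p ^ m"
  have Q: "of_nat CARD('a) = (of_int Q :: complex)" by (simp add: q Q_def)
  note mom = moments[OF g, unfolded \<theta> Q, folded M_def]
  have e1: "x + y + z = 0"
    using mom(1) by (metis of_int_0 of_int_add of_int_eq_iff)
  have "of_int (x\<^sup>2 + y\<^sup>2 + z\<^sup>2) = (of_int (6 * Q) :: complex)" using mom(2) by simp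
  then have e2: "x\<^sup>2 + y\<^sup>2 + z\<^sup>2 = 6 * Q" by (simp only: of_int_eq_iff)
  have "of_int ((Q - 1) * (x * y * z)) = (of_int (Q * (int M - Q\<^sup>2)) :: complex)" using mom(3) by simp
  then have e3: "(Q - 1) * (x * y * z) = Q * (int M - Q\<^sup>2)" by (simp only: of_int_eq_iff)
  have nM: "\<not> int p dvd int M" if p1: "[p = 1] (mod 3)"
  proof
    assume "int p dvd int M"
    then have "(of_nat M :: 'a) = 0"
      by (simp add: of_nat_eq_0_iff_char_dvd CHAR_eq_prime[OF p(1) q])
    then have "p dvd (2 * n choose n)"
      using card_triple_cube_zeros[OF n3 en]
      by (simp add: M_def of_nat_eq_0_iff_char_dvd CHAR_eq_prime[OF p(1) q])
    moreover have "p = 3 * (p div 3) + 1" using p1 by (simp add: cong_def) presburger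
    ultimately show False using prime_not_dvd_central_binomial[OF p(1) _ n_eq] by blast
  qed
  have mod3: "[x = 1] (mod 3)" "[y = 1] (mod 3)" "[z = 1] (mod 3)"
    by (simp_all add: xyz cong_iff_dvd_diff)
  \<comment> \<open>\<open>m = 1\<close> would make the quotient in \<open>dvd\<close> equal to 1,
    and \<open>p = 3\<close> contradicts \<open>p ^ m = 3 * n + 1\<close>; so
    \<open>m \<ge> 2\<close> and \<open>p \<ge> 5\<close>.\<close>
  have Q25: "Q \<ge> 25"
  proof -
    have "m \<noteq> 0" using n_pos q n3 by (cases m) auto
    moreover have "m \<noteq> 1" using dvd p3 by (auto simp: div_self)
    ultimately have "m \<ge> 2" by simp
    have "p \<noteq> 3"
    proof
      assume "p = 3"
      with \<open>m \<noteq> 0\<close> have "3 dvd p ^ m" by (simp add: dvd_power)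
      moreover have "p ^ m = 3 * n + 1" using card_eq q by simp
      ultimately show False by presburger
    qed
    then have "p \<ge> 5" using p p3 by (cases "p = 4") auto
    then have "5 ^ 2 \<le> p ^ 2" by (rule power_mono) simp
    also have "p ^ 2 \<le> p ^ m" using \<open>m \<ge> 2\<close> p3 by (intro power_increasing) auto
    finally show ?thesis unfolding Q_def by (simp flip: of_nat_power)
  qed
  \<comment> \<open>The periods \<open>n\<close> and \<open>- n\<close> would correspond to
    \<open>\<theta> u = Q\<close> and \<open>\<theta> u = 2 - Q\<close>, both too large for
    \<open>w ^ 2 \<le> 6 * Q\<close>.\<close>
  have "\<eta> u \<noteq> of_nat n \<and> \<eta> u \<noteq> - of_nat n" if u: "u \<noteq> 0" for u
  proof -
    have "u \<in> power_residues 3 \<union> (*) g ` power_residues 3 \<union> (*) (g\<^sup>2) ` power_residues 3"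
      using power_residues_3_cosets(1)[OF n3 g] u by blast
    then have "\<theta> u \<in> {\<theta> 1, \<theta> g, \<theta> (g\<^sup>2)}" using \<theta>_mult[of _ 1] by (auto simp: \<theta>_mult)
    then obtain w where w: "\<theta> u = of_int w" "w \<in> {x, y, z}" unfolding \<theta> by blast
    have "x\<^sup>2 \<le> 6 * Q" "y\<^sup>2 \<le> 6 * Q" "z\<^sup>2 \<le> 6 * Q"
      using e2 zero_le_power2[of x] zero_le_power2[of y] zero_le_power2[of z] by linarith+
    then have "w\<^sup>2 \<le> 6 * Q" using w(2) by blast
    have Qn: "Q = 3 * int n + 1" using card_eq q unfolding Q_def by (simp flip: of_nat_power)
    have False if "w = Q \<or> w = 2 - Q"
    proof -
      have "\<bar>w\<bar> \<ge> Q - 2" using that Q25 by auto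
      then have "(Q - 2) * (Q - 2) \<le> \<bar>w\<bar> * \<bar>w\<bar>" using Q25 by (intro mult_mono) auto
      then have "(Q - 2) * (Q - 2) \<le> 6 * Q" using \<open>w\<^sup>2 \<le> 6 * Q\<close> by (simp add: power2_eq_square)
      moreover have "25 * Q \<le> Q * Q" using Q25 by (intro mult_right_mono) auto
      ultimately show False using Q25 by (simp add: algebra_simps)
    qed
    moreover have "w = Q" if "\<eta> u = of_nat n"
    proof -
      have "of_int w = (of_int Q :: complex)" using that by (simp add: \<theta>_eq Qn flip: w(1))
      then show ?thesis by simp
    qed
    moreover have "w = 2 - Q" if "\<eta> u = - of_nat n"
    proof -
      have "of_int w = (of_int (2 - Q) :: complex)" using that by (simp add: \<theta>_eq Qn flip: w(1))
      then show ?thesis by (simp only: of_int_eq_iff)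
    qed
    ultimately show ?thesis by blast
  qed
  then have con: "Digraph_Component.connected (with_proj G)"
    unfolding G by (rule connected_gen_paley_sum_graph)
  have pm: "replicate_mset k (of_int i) + replicate_mset k (- of_int i) = pm_mult ((of_int (1 + 3 * i) - 1) / 3) k" for k i
    by (simp add: pm_mult_def)
  have "graph_eigenvalues G = {#of_nat n#} + pm_mult ((of_int x - 1) / 3) (n div 2) +
      pm_mult ((of_int y - 1) / 3) (n div 2) + pm_mult ((of_int z - 1) / 3) (n div 2)"
    unfolding G graph_eigenvalues_eq[OF g] h xyz pm ..
  then show ?thesis using mod3 e1 e2 e3 nM con unfolding Q_def by blast
qed

theorem theorem2p8:
  fixes p m q n :: nat
    and G :: "'a::{field,finite} pair_pre_digraph"
  assumes "prime p" and "odd p"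
    and "q = p ^ m" and "q \<ge> 5"
    and "3 dvd (q - 1) div (p - 1)"
    and "n = (q - 1) div 3"
    and "CARD('a) = q"
    and "G = gen_paley_sum_graph 3"
  shows
    "Digraph_Component.connected (with_proj G) \<and>
     (\<forall>x \<in># graph_eigenvalues G. x \<in> \<int>) \<and>
     ([p = 1] (mod 3) \<longrightarrow>
        (\<exists>t. m = 3 * t) \<and>
        (let P = (\<lambda>a b :: int. 4 * root 3 (real q) = of_int (a ^ 2 + 27 * b ^ 2) \<and>
                    [a = 1] (mod 3) \<and> coprime a (int p))
         in (\<exists>a b. P a b \<and> (\<forall>a' b'. P a' b' \<longrightarrow> a' = a \<and> (b' = b \<or> b' = - b))) \<and>
            (\<forall>a b. P a b \<longrightarrow>
               graph_eigenvalues G =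
                 {# of_nat n #} +
                 pm_mult ((of_int a * root 3 (real q) - 1) / 3) (n div 2) +
                 pm_mult ((- (1 / 2) * of_int (a + 9 * b) * root 3 (real q) - 1) / 3) (n div 2) +
                 pm_mult ((- (1 / 2) * of_int (a - 9 * b) * root 3 (real q) - 1) / 3) (n div 2)))) \<and>
     ([p = 2] (mod 3) \<longrightarrow>
        (\<exists>t. m = 2 * t) \<and>
        ([m = 0] (mod 4) \<longrightarrow>
           graph_eigenvalues G =
             {# of_nat n #} +
             pm_mult ((sqrt (real q) - 1) / 3) n +
             pm_mult ((- 2 * sqrt (real q) - 1) / 3) (n div 2)) \<and>
        ([m = 2] (mod 4) \<longrightarrow>
           graph_eigenvalues G =
             {# of_nat n #} +
             pm_mult ((2 * sqrt (real q) - 1) / 3) (n div 2) +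
             pm_mult ((- sqrt (real q) - 1) / 3) n))"
proof -
  note p = assms(1,2)
  obtain x y z M :: int where mod3: "[x = 1] (mod 3)" "[y = 1] (mod 3)" "[z = 1] (mod 3)"
    and e: "x + y + z = 0" "x\<^sup>2 + y\<^sup>2 + z\<^sup>2 = 6 * int p ^ m"
      "(int p ^ m - 1) * (x * y * z) = int p ^ m * (M - (int p ^ m)\<^sup>2)"
    and M: "[p = 1] (mod 3) \<Longrightarrow> \<not> int p dvd M"
    and con: "Digraph_Component.connected (with_proj G)"
    and eig: "graph_eigenvalues G = {#of_nat n#} + pm_mult ((of_int x - 1) / 3) (n div 2) +
      pm_mult ((of_int y - 1) / 3) (n div 2) + pm_mult ((of_int z - 1) / 3) (n div 2)"
    using ex_integer_periods[of p m n G] assms by auto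
  have p3: "p \<ge> 3" using p prime_ge_2_nat[of p] by (cases "p = 2") auto
  have m0: "m \<noteq> 0" using assms(3,4) by (cases m) auto
  have geo: "(q - 1) div (p - 1) = (\<Sum>i<m. p ^ i)"
  proof -
    have "int (q - 1) = int ((p - 1) * (\<Sum>i<m. p ^ i))"
      using power_diff_1_eq[of "int p" m] assms(3,4) p3 by (simp add: of_nat_diff)
    then have "q - 1 = (p - 1) * (\<Sum>i<m. p ^ i)" by (simp only: of_nat_eq_iff)
    then show ?thesis using p3 by simp
  qed
  have q3: "3 dvd q - 1"
  proof -
    have "[p ^ m = 1 ^ m] (mod (p - 1))"
      using p3 by (intro cong_pow) (simp add: cong_altdef_nat)
    then have "p - 1 dvd q - 1" unfolding assms(3) by (intro cong_to_1_nat) simp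
    then show ?thesis using assms(5) by (metis dvd_mult dvd_mult_div_cancel)
  qed
  have en: "even n"
  proof -
    have "even (q - 1)" using assms(3,4) p by simp
    moreover have "q - 1 = 3 * n" using assms(6) q3 by simp
    ultimately have "even (3 * n)" by metis
    then show ?thesis by simp
  qed
  have intg: "v \<in> \<int>" if "v \<in># graph_eigenvalues G" for v
  proof -
    have w: "v \<in> \<int>" if "[w = 1] (mod 3)" "v \<in># pm_mult ((of_int w - 1) / 3) (n div 2)" for w :: int
    proof -
      obtain i where "w = 1 + 3 * i"
        using \<open>[w = 1] (mod 3)\<close> by (metis cong_iff_lin cong_sym mult.commute)
      then show ?thesis using that(2) by (auto simp: pm_mult_def split: if_splits)
    qed
    show ?thesis using that mod3 w unfolding eig by auto
  qed
  have part_a: "(\<exists>t. m = 3 * t) \<and>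
        (let P = (\<lambda>a b :: int. 4 * root 3 (real q) = of_int (a ^ 2 + 27 * b ^ 2) \<and>
                    [a = 1] (mod 3) \<and> coprime a (int p))
         in (\<exists>a b. P a b \<and> (\<forall>a' b'. P a' b' \<longrightarrow> a' = a \<and> (b' = b \<or> b' = - b))) \<and>
            (\<forall>a b. P a b \<longrightarrow>
               graph_eigenvalues G =
                 {# of_nat n #} +
                 pm_mult ((of_int a * root 3 (real q) - 1) / 3) (n div 2) +
                 pm_mult ((- (1 / 2) * of_int (a + 9 * b) * root 3 (real q) - 1) / 3) (n div 2) +
                 pm_mult ((- (1 / 2) * of_int (a - 9 * b) * root 3 (real q) - 1) / 3) (n div 2)))"
    if p1: "[p = 1] (mod 3)"
  proof -
    \<comment> \<open>The geometric sum has \<open>m\<close> terms, each congruent to 1, so it is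
      congruent to \<open>m\<close> modulo 3.\<close>
    have "[(\<Sum>i<m. p ^ i) = (\<Sum>i<m. 1 ^ i)] (mod 3)" by (intro cong_sum cong_pow p1)
    then have "3 dvd m" using assms(5) geo by (simp add: cong_dvd_iff)
    then obtain t where t: "m = 3 * t" by auto
    then have t0: "t > 0" using m0 by simp
    define s where "s = int p ^ t"
    have s: "int p ^ m = s ^ 3" "s \<noteq> 0" using p3 by (simp_all add: s_def t mult.commute power_mult)
    have root: "root 3 (real q) = of_int s"
    proof -
      have "real q = (of_int s) ^ 3" by (simp add: assms(3) t s_def mult.commute power_mult)
      then show ?thesis by (simp add: real_root_power_cancel s_def)
    qed
    obtain a b c where abc: "x = s * a" "y = s * b" "z = s * c" "\<not> int p dvd a * b * c"
      using cubic_resolvent_valuations[OF p(1) t0 _ e(1) _ e(3) M[OF p1]] e(2)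
      unfolding s_def t by blast
    have "s * (a + b + c) = 0" using e(1) by (simp add: abc algebra_simps)
    then have abc1: "a + b + c = 0" using s by simp
    have "s\<^sup>2 * (a\<^sup>2 + b\<^sup>2 + c\<^sup>2) = s\<^sup>2 * (6 * s)"
      using e(2) unfolding s(1) by (simp add: abc algebra_simps power2_eq_square power3_eq_cube)
    then have abc2: "a\<^sup>2 + b\<^sup>2 + c\<^sup>2 = 6 * s" using s by simp
    have s1: "[s = 1] (mod 3)"
    proof -
      have "[int p = 1] (mod 3)" using p1 by (metis cong_int_iff of_nat_1 of_nat_numeral)
      then have "[int p ^ t = 1 ^ t] (mod 3)" by (rule cong_pow)
      then show ?thesis by (simp add: s_def)
    qed
    \<comment> \<open>Since \<open>s\<close> is congruent to 1 modulo 3, the cofactors keep the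
      residues of \<open>x\<close>, \<open>y\<close>, \<open>z\<close>.\<close>
    have one: "[w = 1] (mod 3)" if "[s * w = 1] (mod 3)" for w
    proof -
      have "[s * w = 1 * w] (mod 3)" by (intro cong_mult s1 cong_refl)
      then show ?thesis using that by (metis cong_sym cong_trans mult_1)
    qed
    have abc3: "[a = 1] (mod 3)" "[b = 1] (mod 3)" "[c = 1] (mod 3)"
      using mod3 unfolding abc by (auto intro: one)
    obtain a0 b0 u v where r: "{#a0, u, v#} = {#a, b, c#}" "4 * s = a0\<^sup>2 + 27 * b0\<^sup>2"
      "2 * u = - (a0 - 9 * b0)" "2 * v = - (a0 + 9 * b0)"
      using ex_representation[OF abc1 abc2 abc3] by blast
    \<comment> \<open>Being one of the cofactors, \<open>a0\<close> inherits their residue and is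
      prime to \<open>p\<close>.\<close>
    have "a0 \<in># {#a, b, c#}" by (simp flip: r(1))
    then have a0: "[a0 = 1] (mod 3)" "\<not> int p dvd a0" using abc3 abc(4) by auto
    define P where "P a b \<longleftrightarrow> 4 * root 3 (real q) = of_int (a ^ 2 + 27 * b ^ 2) \<and>
        [a = 1] (mod 3) \<and> coprime a (int p)" for a b :: int
    have P_iff: "P a b \<longleftrightarrow> 4 * s = a\<^sup>2 + 27 * b\<^sup>2 \<and> [a = 1] (mod 3) \<and> coprime a (int p)" for a b
    proof -
      have "4 * root 3 (real q) = of_int (4 * s)" by (simp add: root)
      then show ?thesis unfolding P_def by (simp only: of_int_eq_iff)
    qed
    have P0: "P a0 b0"
    proof -
      have "coprime (int p) a0" using a0(2) p(1) by (intro prime_imp_coprime) simp_all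
      then show ?thesis using r(2) a0(1) by (simp add: P_iff coprime_commute)
    qed
    have uniq: "a' = a0 \<and> (b' = b0 \<or> b' = - b0)" if "P a' b'" for a' b'
      using representation_unique[OF p t0, of a0 b0 a' b'] P0 that unfolding P_iff s_def by blast
    define F where "F w = pm_mult ((of_int w * root 3 (real q) - 1) / 3) (n div 2)" for w :: int
    have "graph_eigenvalues G = {#of_nat n#} + (\<Sum>w\<in>#{#a, b, c#}. F w)"
      unfolding eig F_def abc by (simp add: root mult.commute add.assoc)
    also have "\<dots> = {#of_nat n#} + F a0 + F v + F u"
      by (simp flip: r(1))
    finally have eig0: "graph_eigenvalues G = {#of_nat n#} + F a0 + F v + F u" .
    have half: "F w = pm_mult ((- (1 / 2) * of_int d * root 3 (real q) - 1) / 3) (n div 2)"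
      if "2 * w = - d" for w d
    proof -
      have "d = - 2 * w" using that by simp
      then show ?thesis by (simp add: F_def)
    qed
    have "graph_eigenvalues G =
                 {# of_nat n #} +
                 pm_mult ((of_int a' * root 3 (real q) - 1) / 3) (n div 2) +
                 pm_mult ((- (1 / 2) * of_int (a' + 9 * b') * root 3 (real q) - 1) / 3) (n div 2) +
                 pm_mult ((- (1 / 2) * of_int (a' - 9 * b') * root 3 (real q) - 1) / 3) (n div 2)"
      if "P a' b'" for a' b'
    proof -
      \<comment> \<open>Changing the sign of \<open>b'\<close> only swaps the last two blocks of
        eigenvalues.\<close>
      have "a' = a0" "b' = b0 \<or> b' = - b0" using uniq[OF that] by auto
      then show ?thesis
        using eig0 half[OF r(3)] half[OF r(4)] unfolding F_def by (auto simp: add_ac)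
    qed
    then show ?thesis
      unfolding Let_def P_def[symmetric] using t P0 uniq by blast
  qed
  have part_b: "(\<exists>t. m = 2 * t) \<and>
        ([m = 0] (mod 4) \<longrightarrow>
           graph_eigenvalues G =
             {# of_nat n #} +
             pm_mult ((sqrt (real q) - 1) / 3) n +
             pm_mult ((- 2 * sqrt (real q) - 1) / 3) (n div 2)) \<and>
        ([m = 2] (mod 4) \<longrightarrow>
           graph_eigenvalues G =
             {# of_nat n #} +
             pm_mult ((2 * sqrt (real q) - 1) / 3) (n div 2) +
             pm_mult ((- sqrt (real q) - 1) / 3) n)"
    if p2: "[p = 2] (mod 3)"
  proof -
    have pm1: "[int p ^ k = (- 1) ^ k] (mod 3)" for k
    proof (rule cong_pow)
      have "[int p = 2] (mod 3)" using p2 by (metis cong_int_iff of_nat_numeral)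
      then show "[int p = - 1] (mod 3)" by (simp add: cong_def)
    qed
    \<comment> \<open>For odd \<open>m\<close>, \<open>q\<close> would be congruent to 2 modulo
      3.\<close>
    have "even m"
    proof (rule ccontr)
      assume "odd m"
      then have "[int q = - 1] (mod 3)" using pm1[of m] by (simp add: assms(3))
      then have "int q mod 3 = 2" by (simp add: cong_def)
      then show False using q3 assms(4) by presburger
    qed
    then obtain t where t: "m = 2 * t" by auto
    define s where "s = int p ^ t"
    \<comment> \<open>The residue of \<open>s\<close> modulo 3, and therefore also of the cofactors.
      It is 1 exactly if 4 divides \<open>m\<close>.\<close>
    define \<epsilon> where "\<epsilon> = (- 1 :: int) ^ t"
    have s: "int p ^ m = s\<^sup>2" "s \<noteq> 0" using p3 by (simp_all add: s_def t mult.commute power_mult)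
    have sqrt: "sqrt (real q) = of_int s"
    proof -
      have "real q = (of_int s)\<^sup>2" by (simp add: assms(3) t s_def mult.commute power_mult)
      then show ?thesis by (simp add: s_def)
    qed
    have z: "z = - x - y" using e(1) by simp
    have xy: "x\<^sup>2 + x * y + y\<^sup>2 = 3 * int p ^ m"
      using e(2) unfolding z by (simp add: algebra_simps power2_eq_square)
    then obtain a b where ab: "x = s * a" "y = s * b"
      using prime_power_divides_quadratic_form[OF p p2, of x y t] unfolding s_def t by (auto elim!: dvdE)
    have "s\<^sup>2 * (a\<^sup>2 + a * b + b\<^sup>2) = s\<^sup>2 * 3"
      using xy unfolding s(1) by (simp add: ab algebra_simps power2_eq_square)
    then have ab3: "a\<^sup>2 + a * b + b\<^sup>2 = 3" using s by simp
    have s1: "[s = \<epsilon>] (mod 3)" unfolding s_def \<epsilon>_def by (rule pm1)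
    have \<epsilon>: "\<epsilon> = 1 \<or> \<epsilon> = - 1" unfolding \<epsilon>_def by (cases "even t") auto
    have sgn: "[w = \<epsilon>] (mod 3)" if "[s * w = 1] (mod 3)" for w
    proof -
      have "[\<epsilon> * w = s * w] (mod 3)" by (intro cong_mult cong_sym[OF s1] cong_refl)
      then have "[\<epsilon> * w = 1] (mod 3)" using that by (rule cong_trans)
      then have "[\<epsilon> * (\<epsilon> * w) = \<epsilon> * 1] (mod 3)" by (intro cong_mult cong_refl)
      then show ?thesis using \<epsilon> by auto
    qed
    have "(a, b) \<in> {(\<epsilon>, \<epsilon>), (\<epsilon>, - 2 * \<epsilon>), (- 2 * \<epsilon>, \<epsilon>)}"
      using mod3 unfolding ab by (intro quadratic_form_eq_3 ab3 sgn \<epsilon>)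
    \<comment> \<open>The third cofactor is \<open>- a - b\<close>, and the three possible pairs
      differ only in the order of the cofactors.\<close>
    then have "{#a, b, - a - b#} = {#\<epsilon>, \<epsilon>, - 2 * \<epsilon>#}" by (auto simp: add_mset_commute)
    moreover define F where "F w = pm_mult ((of_int w * sqrt (real q) - 1) / 3) (n div 2)" for w :: int
    have "graph_eigenvalues G = {#of_nat n#} + (\<Sum>w\<in>#{#a, b, - a - b#}. F w)"
      unfolding eig F_def z ab by (simp add: sqrt algebra_simps)
    ultimately have eig0: "graph_eigenvalues G = {#of_nat n#} + (F \<epsilon> + F \<epsilon>) + F (- 2 * \<epsilon>)"
      by (simp add: add.assoc)
    \<comment> \<open>The cofactor \<open>\<epsilon>\<close> occurs twice, so its two blocks merge
      into multiplicity \<open>n\<close>.\<close>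
    have dbl: "pm_mult r (n div 2) + pm_mult r (n div 2) = pm_mult r n" for r
    proof -
      obtain k where "n = k + k" using en by (auto simp: mult_2 elim!: evenE)
      moreover from this have "n div 2 = k" by simp
      ultimately show ?thesis
        by (intro multiset_eqI) (simp add: pm_mult_def)
    qed
    have "graph_eigenvalues G = {#of_nat n#} + pm_mult ((sqrt (real q) - 1) / 3) n +
             pm_mult ((- 2 * sqrt (real q) - 1) / 3) (n div 2)" if "[m = 0] (mod 4)"
    proof -
      have "even t" using that unfolding t cong_def by presburger
      then have "\<epsilon> = 1" by (simp add: \<epsilon>_def)
      then show ?thesis using eig0 unfolding F_def dbl by simp
    qed
    moreover have "graph_eigenvalues G = {#of_nat n#} +
             pm_mult ((2 * sqrt (real q) - 1) / 3) (n div 2) +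
             pm_mult ((- sqrt (real q) - 1) / 3) n" if "[m = 2] (mod 4)"
    proof -
      have "odd t" using that unfolding t cong_def by presburger
      then have "\<epsilon> = - 1" by (simp add: \<epsilon>_def)
      then show ?thesis using eig0 unfolding F_def dbl by (simp add: add_ac)
    qed
    ultimately show ?thesis using t by blast
  qed
  show ?thesis using con intg part_a part_b by blast
qed

end
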